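(* Let $\{\eta_n\}_{n\ge1}$ be i.i.d. real random variables with distribution function $F(x)=\mathbf P(\eta_1\le x)$, $R_n=\max\{R_{n-1}-1,\eta_n\}$ for $n\ge1$, and $T^{(R)}_{x_0}=\inf\{k\ge1: R_k\le x_0\}$. Assume that $x_0$ is such that $\mathbf P(\eta_1\le x_0)\,\mathbf P(\eta_1>x_0)>0$. Assume also that $\mathbf E\eta_1<\infty$ and that $F\in\mathcal S^*$. Then, for any $x>x_0$, $$\mathbf P_x\left(T^{(R)}_{x_0}>n\right)\sim\mathbf E_x\left[T^{(R)}_{x_0}\right]\mathbf P(\eta_1>n),\qquad n\to\infty.$$ The expectation $\mathbf E_x[T^{(R)}_{x_0}]$ can be computed explicitly: for every integer $n\ge0$ and every $x\in(x_0+n,x_0+n+1]$ one has $$\mathbf E_x\left[T^{(R)}_{x_0}\right]=\frac{1}{\prod_{k=0}^\infty\mathbf P(\eta_1\le x_0+k)}\left(1+\sum_{j=1}^n\prod_{k=0}^{j-1}\mathbf P(\eta_1\le x_0+k)\right).$$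
   Context: $\mathbf P_x,\mathbf E_x$ refer to the chain started at $R_0=x$. Class $\mathcal S^*$ (strong subexponential distributions): with $\overline F=1-F$, a distribution function $F$ with $\mu_+=\int_0^\infty\overline F(y)\,dy<\infty$ belongs to $\mathcal S^*$ if $\overline F(x)>0$ for all $x$ and $$\frac{\int_0^x\overline F(x-y)\overline F(y)\,dy}{\overline F(x)}\to2\mu_+\qquad\text{as }x\to\infty.$$ *)

theory Defs
  imports "HOL-Probability.Probability" "HOL-Library.Landau_Symbols"
begin

definition is_distribution_function :: "(real \<Rightarrow> real) \<Rightarrow> bool" where
  "is_distribution_function F \<longleftrightarrow> (\<exists>D. real_distribution D \<and> F = cdf D)"

(* Strong subexponential distributions. The tail is nonnegative, so integrability of the tail
   over {0..} expresses finiteness of mu_plus, the Lebesgue integral of the tail over {0..}. *)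
definition S_star :: "(real \<Rightarrow> real) set" where
  "S_star = {F. is_distribution_function F \<and>
     set_integrable lborel {0..} (\<lambda>y. 1 - F y) \<and>
     (\<forall>x. 1 - F x > 0) \<and>
     ((\<lambda>x. (LINT y:{0..x}|lborel. (1 - F (x - y)) * (1 - F y)) / (1 - F x))
        \<longlongrightarrow> 2 * (LINT y:{0..}|lborel. 1 - F y)) at_top}"

(* The chain R_n = max {R_(n-1) - 1, eta_n} with R_0 = x. The innovations are indexed from 1;
   the value of eta at index 0 is never used. *)
primrec max_chain :: "(nat \<Rightarrow> 'a \<Rightarrow> real) \<Rightarrow> real \<Rightarrow> nat \<Rightarrow> 'a \<Rightarrow> real" where
  "max_chain \<eta> x 0 \<omega> = x"
| "max_chain \<eta> x (Suc n) \<omega> = max (max_chain \<eta> x n \<omega> - 1) (\<eta> (Suc n) \<omega>)"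

(* Time of the first visit (k >= 1) to (-infinity, x0] of the chain started at x.
   It is infinite when there is no such visit, as the infimum of {} in enat is infinity. *)
definition hitting_time :: "(nat \<Rightarrow> 'a \<Rightarrow> real) \<Rightarrow> real \<Rightarrow> real \<Rightarrow> 'a \<Rightarrow> enat" where
  "hitting_time \<eta> x0 x \<omega> = Inf {enat k |k. k \<ge> 1 \<and> max_chain \<eta> x k \<omega> \<le> x0}"

definition expected_hitting_time ::
  "'a measure \<Rightarrow> (nat \<Rightarrow> 'a \<Rightarrow> real) \<Rightarrow> real \<Rightarrow> real \<Rightarrow> ennreal" where
  "expected_hitting_time M \<eta> x0 x =
     (\<integral>\<^sup>+ \<omega>. ennreal_of_enat (hitting_time \<eta> x0 x \<omega>) \<partial>M)"

end

theory Submission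
  imports Defs
begin

text \<open>
  Once the chain is at or below \<open>x0\<close>, its past has no influence on later visits to the half-line
  below \<open>x0\<close>, so these visits are renewals. After \<open>i\<close> steps a renewal recurs with probability \<open>u i\<close>, the
  product of \<open>P (\<eta> 1 \<le> x0 + j)\<close> over \<open>j < i\<close>, because the innovation of age \<open>j\<close> must not exceed
  \<open>x0 + j\<close>. Let \<open>r s\<close> be the probability of no renewal during the next \<open>s\<close> steps. Splitting
  according to the last renewal gives \<open>(\<Sum>i\<le>n. u i * r (n - i)) = 1\<close>
  (\<open>visit_avoid_convolution\<close>), and for a start in \<open>(x0 + n, x0 + n + 1]\<close> the hitting time exceeds
  \<open>m\<close> with probability equal to the sum of \<open>u l * r (m - l)\<close> over \<open>l \<le> min n m\<close>
  (\<open>prob_hitting_time_gt\<close>).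

  The tail of \<open>\<eta> 1\<close> is summable over the integers, so \<open>u\<close> decreases to a positive limit \<open>P\<close>, the
  infinite product. Differencing the convolution identity yields a defective renewal equation for
  \<open>r\<close> with step weights \<open>b i = u i - u (i + 1) = u i * P (\<eta> 1 > x0 + i)\<close> of total mass \<open>1 - P\<close>.
  Summation gives the sum \<open>1 / P\<close> for \<open>r\<close> (\<open>renewal_sums\<close>) and with it the formula for the expected
  hitting time.

  The asymptotics rest on the principle of one big jump. Membership in the class of strong
  subexponential distributions makes the tail insensitive to shifts and makes convolutions of the
  tail over the integers negligible away from both ends (\<open>discrete_subexp_tail\<close>). The weights \<open>b n\<close>
  are equivalent to \<open>P\<close> times the tail at \<open>n\<close>. A defective renewal sequence inherits the decay of its
  weights (\<open>defective_renewal_asymptotics\<close>), here with constant \<open>1 / P\<close>, the same as the sum of \<open>r\<close>.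
  In the finite sum for the hitting time each \<open>r (m - l)\<close> may then be replaced by the tail at \<open>m\<close>
  divided by \<open>P\<close>, and the resulting factor is the expectation.
\<close>

section \<open>Defective renewal equations with subexponential steps\<close>

text \<open>In a self-convolution of \<open>g\<close>, the two end blocks are governed by the ratio condition. The last
  clause says that the block between them is negligible compared with \<open>g n\<close>: one big jump
  dominates two medium ones. This form is used because it survives when the factors of the
  convolution are replaced by sequences bounded by multiples of \<open>g\<close>.\<close>

definition discrete_subexp :: "(nat \<Rightarrow> real) \<Rightarrow> bool" where
  "discrete_subexp g \<longleftrightarrow> (\<forall>n. 0 < g n) \<and> decseq g \<and> (\<lambda>n. g n / g (Suc n)) \<longlonglongrightarrow> 1 \<and>
     (\<forall>\<epsilon>>0. \<exists>A. \<forall>\<^sub>F n in sequentially. (\<Sum>i\<in>{A<..<n-A}. g i * g (n - i)) \<le> \<epsilon> * g n)"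

lemma ratio_shift_tendsto:
  fixes g :: "nat \<Rightarrow> real"
  assumes pos: "\<And>n. 0 < g n" and ratio: "(\<lambda>n. g n / g (Suc n)) \<longlonglongrightarrow> 1"
  shows "(\<lambda>n. g n / g (n + m)) \<longlonglongrightarrow> 1"
proof (induction m)
  case 0
  have "g n / g (n + 0) = 1" for n using pos[of n] by simp
  then show ?case by simp
next
  case (Suc m)
  have "(\<lambda>n. g n / g (n + m) * (g (n + m) / g (Suc (n + m)))) \<longlonglongrightarrow> 1 * 1"
    by (intro tendsto_mult Suc LIMSEQ_ignore_initial_segment[OF ratio])
  moreover have "g n / g (n + m) * (g (n + m) / g (Suc (n + m))) = g n / g (n + Suc m)" for n
    using pos[of "n + m"] by simp
  ultimately show ?case by (simp only: mult_1)
qed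

lemma ratio_back_tendsto:
  fixes g :: "nat \<Rightarrow> real"
  assumes pos: "\<And>n. 0 < g n" and ratio: "(\<lambda>n. g n / g (Suc n)) \<longlonglongrightarrow> 1"
  shows "(\<lambda>n. g (n - j) / g (Suc n)) \<longlonglongrightarrow> 1"
proof (rule LIMSEQ_offset[where k = j])
  show "(\<lambda>n. g (n + j - j) / g (Suc (n + j))) \<longlonglongrightarrow> 1"
    using ratio_shift_tendsto[OF assms, of "Suc j"] by simp
qed

text \<open>The three blocks in which the first factor has a small index, both indices are large, or the
  second factor has a small index.\<close>

lemma convolution_split:
  fixes b r :: "nat \<Rightarrow> real"
  assumes "2 * A < n"
  shows "(\<Sum>j\<le>n. b j * r (n - j)) = (\<Sum>j\<le>A. b j * r (n - j))
     + (\<Sum>j\<in>{A<..<n-A}. b j * r (n - j)) + (\<Sum>i\<le>A. r i * b (n - i))"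
proof -
  have set: "{..n} = ({..A} \<union> {A<..<n-A}) \<union> {n-A..n}" using assms by auto
  have "(\<Sum>j\<in>{n-A..n}. b j * r (n - j)) = (\<Sum>i\<le>A. r i * b (n - i))"
    by (rule sum.reindex_bij_witness[where i = "\<lambda>i. n - i" and j = "\<lambda>i. n - i"])
      (use assms in auto)
  moreover have "(\<Sum>j\<le>n. b j * r (n - j)) = (\<Sum>j\<in>{..A} \<union> {A<..<n-A}. b j * r (n - j))
      + (\<Sum>j\<in>{n-A..n}. b j * r (n - j))"
    unfolding set by (rule sum.union_disjoint) (use assms in auto)
  moreover have "(\<Sum>j\<in>{..A} \<union> {A<..<n-A}. b j * r (n - j)) = (\<Sum>j\<le>A. b j * r (n - j))
      + (\<Sum>j\<in>{A<..<n-A}. b j * r (n - j))"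
    by (rule sum.union_disjoint) auto
  ultimately show ?thesis by simp
qed

text \<open>The least eventual bound \<open>b\<close> of \<open>e\<close> satisfies \<open>b \<le> D * b\<close>, up to an arbitrary \<open>\<epsilon>\<close>, so it is zero.
  Phrasing the contraction with eventual bounds avoids any upper limit of \<open>e\<close>.\<close>

lemma contraction_tendsto_zero:
  fixes e :: "nat \<Rightarrow> real"
  assumes D: "0 \<le> D" "D < 1" and nonneg: "\<And>n. 0 \<le> e n" and bounded: "\<And>n. e n \<le> K"
    and contr: "\<And>B \<epsilon>. 0 < \<epsilon> \<Longrightarrow> \<forall>\<^sub>F n in sequentially. e n \<le> B \<Longrightarrow>
                  \<forall>\<^sub>F n in sequentially. e n \<le> D * B + \<epsilon>"
  shows "e \<longlonglongrightarrow> 0"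
proof -
  define S where "S = {B. \<forall>\<^sub>F n in sequentially. e n \<le> B}"
  have K: "K \<in> S" using bounded by (simp add: S_def)
  have S0: "0 \<le> B" if "B \<in> S" for B
  proof -
    from that obtain n where "e n \<le> B"
      unfolding S_def by (auto simp: eventually_sequentially)
    with nonneg[of n] show ?thesis by simp
  qed
  have bdd: "bdd_below S" by (rule bdd_belowI[of _ 0]) (rule S0)
  define b where "b = Inf S"
  have b0: "0 \<le> b" unfolding b_def using K S0 by (intro cInf_greatest) auto
  have "b = 0"
  proof (rule ccontr)
    assume "b \<noteq> 0"
    define \<epsilon> where "\<epsilon> = (1 - D) * b / 4"
    have \<epsilon>: "0 < \<epsilon>" using \<open>b \<noteq> 0\<close> b0 D by (simp add: \<epsilon>_def)
    have "Inf S < b + \<epsilon>" using \<epsilon> by (simp add: b_def)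
    then obtain B where B: "B \<in> S" "B < b + \<epsilon>"
      using cInf_lessD[of S "b + \<epsilon>"] K by auto
    have "D * B + \<epsilon> \<in> S" using contr[OF \<epsilon>, of B] B by (simp add: S_def)
    then have "b \<le> D * B + \<epsilon>" unfolding b_def by (rule cInf_lower[OF _ bdd])
    also have "D * B \<le> D * (b + \<epsilon>)" using B D by (intro mult_left_mono) auto
    also have "D * (b + \<epsilon>) + \<epsilon> \<le> D * b + 2 * \<epsilon>"
      using mult_right_mono[of D 1 \<epsilon>] D \<epsilon> by (simp add: algebra_simps)
    also have "\<dots> < b"
    proof -
      have "0 < (1 - D) * b" using \<open>b \<noteq> 0\<close> b0 D by simp
      moreover have "\<epsilon> = ((1 - D) * b) / 4" "(1 - D) * b = b - D * b"
        by (simp_all add: \<epsilon>_def algebra_simps)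
      ultimately show ?thesis by linarith
    qed
    finally show False by simp
  qed
  show ?thesis
  proof (rule LIMSEQ_I)
    fix \<epsilon> :: real assume "0 < \<epsilon>"
    then obtain B where "B \<in> S" "B < \<epsilon>"
      using cInf_lessD[of S \<epsilon>] K \<open>b = 0\<close> unfolding b_def by auto
    then show "\<exists>no. \<forall>n\<ge>no. norm (e n - 0) < \<epsilon>"
      using nonneg unfolding S_def eventually_sequentially by fastforce
  qed
qed

text \<open>If \<open>r \<le> K * g\<close> holds below \<open>n + 1\<close>, splitting the recursion into three blocks
  reproduces the bound at \<open>n + 1\<close> with constant \<open>\<rho> * K + C\<close>. Here \<open>\<rho>\<close> is only slightly above the mass
  of \<open>b\<close>, which is less than 1, and \<open>C\<close> does not depend on \<open>K\<close>, because the last block is estimated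
  with the sum of \<open>r\<close> and not with \<open>K\<close>. Hence any \<open>K \<ge> C / (1 - \<rho>)\<close> that is
  large enough for the finitely many initial indices propagates.\<close>

lemma defective_renewal_bounded:
  fixes b g r :: "nat \<Rightarrow> real"
  assumes g: "discrete_subexp g"
    and b0: "\<And>n. 0 \<le> b n" and bK: "\<And>n. b n \<le> K' * g n" and D: "summable b" "suminf b < 1"
    and r0: "\<And>n. 0 \<le> r n" and R: "summable r"
    and rec: "\<And>n. r (Suc n) = (\<Sum>j\<le>n. b j * r (n - j))"
  shows "\<exists>K\<ge>0. \<forall>n. r n \<le> K * g n"
proof -
  have pos: "0 < g n" for n using g by (simp add: discrete_subexp_def)
  have dec: "m \<le> n \<Longrightarrow> g n \<le> g m" for m n
    using g by (auto simp: discrete_subexp_def decseq_def)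
  have ratio: "(\<lambda>n. g n / g (Suc n)) \<longlonglongrightarrow> 1" using g by (simp add: discrete_subexp_def)
  have K'0: "0 \<le> K'" using order_trans[OF b0[of 0] bK[of 0]] pos[of 0]
    by (simp add: zero_le_mult_iff)
  define d where "d = suminf b"
  \<comment> \<open>With this \<open>\<epsilon>\<close> the middle block costs at most half of the gap \<open>1 - d\<close>; \<open>\<rho>\<close> leaves room for the ratio \<open>\<gamma>\<close>.\<close>
  define \<epsilon> where "\<epsilon> = (1 - d) / (2 * (K' + 1))"
  define \<rho> where "\<rho> = (1 + (d + K' * \<epsilon>)) / 2"
  have d0: "0 \<le> d" "d < 1" using D suminf_nonneg[OF D(1)] b0 by (auto simp: d_def)
  have \<epsilon>: "0 < \<epsilon>" using d0 K'0 by (simp add: \<epsilon>_def)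
  have "2 * (K' + 1) * \<epsilon> = 1 - d" using K'0 by (simp add: \<epsilon>_def)
  then have small: "d + K' * \<epsilon> < 1" using \<epsilon> K'0 d0 mult_nonneg_nonneg[of K' \<epsilon>]
    by (simp add: algebra_simps)
  have small0: "0 \<le> d + K' * \<epsilon>" using d0 K'0 \<epsilon> by simp
  have \<rho>: "d + K' * \<epsilon> < \<rho>" "\<rho> < 1" "0 \<le> \<rho>" using small small0 by (auto simp: \<rho>_def)
  obtain A where A: "\<forall>\<^sub>F n in sequentially. (\<Sum>i\<in>{A<..<n-A}. g i * g (n - i)) \<le> \<epsilon> * g n"
    using g \<epsilon> unfolding discrete_subexp_def by blast
  have \<gamma>: "(\<lambda>n. g (n - A) / g (Suc n)) \<longlonglongrightarrow> 1" by (rule ratio_back_tendsto[OF pos ratio])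
  have \<gamma>1: "\<forall>\<^sub>F n in sequentially. g (n - A) / g (Suc n) * (d + K' * \<epsilon>) < \<rho>"
    by (rule order_tendstoD(2)[OF _ \<rho>(1)]) (use tendsto_mult_right[OF \<gamma>, of "d + K' * \<epsilon>"] in simp)
  have \<gamma>2: "\<forall>\<^sub>F n in sequentially. g (n - A) / g (Suc n) < 2"
    by (rule order_tendstoD(2)[OF \<gamma>]) simp
  have "\<forall>\<^sub>F n in sequentially. 2 * A < n" by (rule eventually_gt_at_top)
  with A \<gamma>1 \<gamma>2 have "\<forall>\<^sub>F n in sequentially. (\<Sum>i\<in>{A<..<n-A}. g i * g (n - i)) \<le> \<epsilon> * g n
     \<and> g (n - A) / g (Suc n) * (d + K' * \<epsilon>) < \<rho> \<and> g (n - A) / g (Suc n) < 2 \<and> 2 * A < n"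
    by eventually_elim auto
  then obtain N where N: "\<And>n. N \<le> n \<Longrightarrow> (\<Sum>i\<in>{A<..<n-A}. g i * g (n - i)) \<le> \<epsilon> * g n
     \<and> g (n - A) / g (Suc n) * (d + K' * \<epsilon>) < \<rho> \<and> g (n - A) / g (Suc n) < 2 \<and> 2 * A < n"
    by (auto simp: eventually_sequentially)
  define C where "C = 2 * K' * suminf r"
  have C0: "0 \<le> C" using K'0 suminf_nonneg[OF R] r0 by (simp add: C_def)
  define K where "K = max (Max ((\<lambda>i. r i / g i) ` {..N})) (C / (1 - \<rho>))"
  have K0: "0 \<le> K" using C0 \<rho> by (simp add: K_def le_max_iff_disj)
  have CK: "C \<le> (1 - \<rho>) * K"
  proof -
    have "C / (1 - \<rho>) \<le> K" by (simp add: K_def)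
    then show ?thesis using \<rho> by (simp add: field_simps)
  qed
  have "r n \<le> K * g n" for n
  proof (induction n rule: less_induct)
    case (less n)
    show ?case
    proof (cases "n \<le> N")
      case True
      then have "r n / g n \<le> Max ((\<lambda>i. r i / g i) ` {..N})" by (intro Max_ge) auto
      then have "r n / g n \<le> K" by (simp add: K_def)
      then show ?thesis using pos[of n] by (simp add: field_simps)
    next
      case False
      then obtain m where m: "n = Suc m" "N \<le> m" by (cases n) auto
      note Nm = N[OF m(2)]
      have IH: "r i \<le> K * g i" if "i \<le> m" for i using less that m by simp
      have "(\<Sum>j\<le>A. b j * r (m - j)) \<le> (\<Sum>j\<le>A. b j * (K * g (m - A)))"
      proof (intro sum_mono mult_left_mono b0)
        fix j assume "j \<in> {..A}"
        then have "g (m - j) \<le> g (m - A)" by (intro dec) auto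
        then show "r (m - j) \<le> K * g (m - A)"
          using order_trans[OF IH[of "m - j"] mult_left_mono[OF _ K0]] by simp
      qed
      also have "\<dots> = (\<Sum>j\<le>A. b j) * (K * g (m - A))" by (simp add: sum_distrib_right)
      also have "\<dots> \<le> d * (K * g (m - A))"
        unfolding d_def using K0 pos[of "m - A"] b0
        by (intro mult_right_mono sum_le_suminf D) auto
      finally have 1: "(\<Sum>j\<le>A. b j * r (m - j)) \<le> d * (K * g (m - A))" .
      have "(\<Sum>j\<in>{A<..<m-A}. b j * r (m - j)) \<le> (\<Sum>j\<in>{A<..<m-A}. (K' * g j) * (K * g (m - j)))"
        using pos K'0 by (intro sum_mono mult_mono bK IH r0) (auto simp: less_imp_le)
      also have "\<dots> = K' * K * (\<Sum>j\<in>{A<..<m-A}. g j * g (m - j))"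
        by (simp add: sum_distrib_left mult_ac)
      also have "\<dots> \<le> K' * K * (\<epsilon> * g m)"
        using Nm K'0 K0 by (intro mult_left_mono) auto
      also have "\<dots> \<le> K' * K * (\<epsilon> * g (m - A))"
        using K'0 K0 \<epsilon> dec[of "m - A" m] by (intro mult_left_mono) auto
      finally have 2: "(\<Sum>j\<in>{A<..<m-A}. b j * r (m - j)) \<le> K' * K * (\<epsilon> * g (m - A))" .
      have "(\<Sum>i\<le>A. r i * b (m - i)) \<le> (\<Sum>i\<le>A. r i * (K' * g (m - A)))"
      proof (intro sum_mono mult_left_mono r0)
        fix j assume "j \<in> {..A}"
        then have "g (m - j) \<le> g (m - A)" by (intro dec) auto
        then show "b (m - j) \<le> K' * g (m - A)"
          using order_trans[OF bK[of "m - j"] mult_left_mono[OF _ K'0]] by simp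
      qed
      also have "\<dots> = (\<Sum>j\<le>A. r j) * (K' * g (m - A))" by (simp add: sum_distrib_right)
      also have "\<dots> \<le> suminf r * (K' * g (m - A))"
        using K'0 pos[of "m - A"] r0 by (intro mult_right_mono sum_le_suminf R) auto
      finally have 3: "(\<Sum>i\<le>A. r i * b (m - i)) \<le> suminf r * (K' * g (m - A))" .
      define \<gamma> where "\<gamma> = g (m - A) / g (Suc m)"
      have g\<gamma>: "g (m - A) = \<gamma> * g n" using pos[of "Suc m"] m by (simp add: \<gamma>_def)
      have "r n \<le> d * (K * g (m - A)) + K' * K * (\<epsilon> * g (m - A)) + suminf r * (K' * g (m - A))"
        unfolding m rec using convolution_split[of A m b r] Nm 1 2 3 by linarith
      also have "\<dots> = (K * (\<gamma> * (d + K' * \<epsilon>)) + \<gamma> * (K' * suminf r)) * g n"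
        unfolding g\<gamma> by (simp add: algebra_simps)
      also have "\<dots> \<le> (K * \<rho> + 2 * (K' * suminf r)) * g n"
        using Nm K0 pos[of n] K'0 suminf_nonneg[OF R] r0
        by (intro mult_right_mono add_mono mult_left_mono) (auto simp: \<gamma>_def)
      also have "\<dots> \<le> K * g n"
        using CK pos[of n] by (intro mult_right_mono) (auto simp: C_def algebra_simps)
      finally show ?thesis .
    qed
  qed
  with K0 show ?thesis by blast
qed


text \<open>If \<open>L\<close> is the limit of \<open>r / g\<close>, dividing the recursion by \<open>g\<close> and letting first \<open>n\<close> and then
  the block length tend to infinity gives \<open>L = suminf b * L + \<beta> * suminf r\<close>: either the renewal
  part \<open>r\<close> or the step \<open>b\<close> carries the big jump. The same computation, applied to the distance of
  \<open>r / g\<close> from the fixed point of this equation, shows that the distance contracts by the factor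
  \<open>suminf b\<close>, which proves that the limit exists.\<close>

theorem defective_renewal_asymptotics:
  fixes b g r :: "nat \<Rightarrow> real"
  assumes g: "discrete_subexp g"
    and b0: "\<And>n. 0 \<le> b n" and b\<beta>: "(\<lambda>n. b n / g n) \<longlonglongrightarrow> \<beta>"
    and D: "summable b" "suminf b < 1"
    and r0: "\<And>n. 0 \<le> r n" and R: "summable r"
    and rec: "\<And>n. r (Suc n) = (\<Sum>j\<le>n. b j * r (n - j))"
  shows "(\<lambda>n. r n / g n) \<longlonglongrightarrow> \<beta> * suminf r / (1 - suminf b)"
proof -
  have pos: "0 < g n" for n using g by (simp add: discrete_subexp_def)
  have ratio: "(\<lambda>n. g n / g (Suc n)) \<longlonglongrightarrow> 1" using g by (simp add: discrete_subexp_def)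
  have \<gamma>: "(\<lambda>n. g (n - j) / g (Suc n)) \<longlonglongrightarrow> 1" for j by (rule ratio_back_tendsto[OF pos ratio])
  obtain K' where K': "0 < K'" "\<And>n. norm (b n / g n) \<le> K'"
    using convergent_imp_Bseq[OF convergentI[OF b\<beta>]] unfolding Bseq_def by blast
  have bK: "b n \<le> K' * g n" for n
    using K'(2)[of n] b0[of n] pos[of n] by (simp add: divide_le_eq)
  obtain K where K: "0 \<le> K" "\<And>n. r n \<le> K * g n"
    using defective_renewal_bounded[OF g b0 bK D r0 R rec] by blast
  define d where "d = suminf b"
  define L where "L = \<beta> * suminf r / (1 - d)"
  have d0: "0 \<le> d" "d < 1" using D suminf_nonneg[OF D(1)] b0 by (auto simp: d_def)
  have fixed_point: "L = d * L + \<beta> * suminf r" using d0 by (simp add: L_def field_simps)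
  define q where "q n = r n / g n" for n
  have q0: "0 \<le> q n" for n using r0[of n] pos[of n] by (simp add: q_def)
  have qK: "q n \<le> K" for n using K(2)[of n] pos[of n] by (simp add: q_def divide_le_eq)
  have "(\<lambda>n. \<bar>q n - L\<bar>) \<longlonglongrightarrow> 0"
  proof (rule contraction_tendsto_zero[OF d0])
    show "\<bar>q n - L\<bar> \<le> K + \<bar>L\<bar>" for n using q0[of n] qK[of n] by linarith
  next
    fix B \<epsilon> :: real
    assume \<epsilon>: "0 < \<epsilon>" and B: "\<forall>\<^sub>F n in sequentially. \<bar>q n - L\<bar> \<le> B"
    then obtain n0 where n0: "\<And>n. n0 \<le> n \<Longrightarrow> \<bar>q n - L\<bar> \<le> B" by (auto simp: eventually_sequentially)
    have B0: "0 \<le> B" using n0[of n0] by linarith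
    define \<delta> where "\<delta> = \<epsilon> / 5"
    have \<delta>: "0 < \<delta>" using \<epsilon> by (simp add: \<delta>_def)
    define \<epsilon>' where "\<epsilon>' = \<delta> / (2 * K' * (K + 1))"
    have \<epsilon>': "0 < \<epsilon>'" using \<delta> K K' by (simp add: \<epsilon>'_def)
    obtain A0 where A0: "\<forall>\<^sub>F n in sequentially. (\<Sum>i\<in>{A0<..<n-A0}. g i * g (n - i)) \<le> \<epsilon>' * g n"
      using g \<epsilon>' unfolding discrete_subexp_def by blast
    have "(\<lambda>A. L * (\<Sum>j\<le>A. b j)) \<longlonglongrightarrow> L * suminf b"
      by (intro tendsto_mult_left summable_LIMSEQ' D)
    then obtain A1 where A1: "\<And>A. A1 \<le> A \<Longrightarrow> \<bar>L * (\<Sum>j\<le>A. b j) - L * d\<bar> < \<delta>"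
      using \<delta> unfolding d_def by (metis LIMSEQ_D real_norm_def)
    have "(\<lambda>A. \<beta> * (\<Sum>j\<le>A. r j)) \<longlonglongrightarrow> \<beta> * suminf r"
      by (intro tendsto_mult_left summable_LIMSEQ' R)
    then obtain A2 where A2: "\<And>A. A2 \<le> A \<Longrightarrow> \<bar>\<beta> * (\<Sum>j\<le>A. r j) - \<beta> * suminf r\<bar> < \<delta>"
      using \<delta> by (metis LIMSEQ_D real_norm_def)
    \<comment> \<open>The middle-block condition persists for longer end blocks, so one \<open>A\<close> serves all three purposes.\<close>
    define A where "A = A0 + A1 + A2"
    have head: "\<bar>L * (\<Sum>j\<le>A. b j) - L * d\<bar> < \<delta>" using A1[of A] by (simp add: A_def)
    have tail: "\<bar>\<beta> * (\<Sum>j\<le>A. r j) - \<beta> * suminf r\<bar> < \<delta>" using A2[of A] by (simp add: A_def)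
    have mid: "\<forall>\<^sub>F n in sequentially. (\<Sum>i\<in>{A<..<n-A}. g i * g (n - i)) \<le> \<epsilon>' * g n"
      using A0
    proof eventually_elim
      case (elim n)
      have "(\<Sum>i\<in>{A<..<n-A}. g i * g (n - i)) \<le> (\<Sum>i\<in>{A0<..<n-A0}. g i * g (n - i))"
        using pos by (intro sum_mono2) (auto simp: A_def less_imp_le)
      with elim show ?case by simp
    qed
    have S1: "(\<lambda>n. \<Sum>j\<le>A. b j * (g (n - j) / g (Suc n) * B + \<bar>L\<bar> * \<bar>g (n - j) / g (Suc n) - 1\<bar>))
        \<longlonglongrightarrow> (\<Sum>j\<le>A. b j * (1 * B + \<bar>L\<bar> * \<bar>1 - 1\<bar>))"
      by (intro tendsto_intros \<gamma>)
    have "(\<Sum>j\<le>A. b j * (1 * B + \<bar>L\<bar> * \<bar>1 - 1\<bar>)) = (\<Sum>j\<le>A. b j) * B"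
      by (simp add: sum_distrib_right)
    also have "\<dots> \<le> d * B"
      unfolding d_def using B0 b0 by (intro mult_right_mono sum_le_suminf D) auto
    also have "\<dots> < d * B + \<delta>" using \<delta> by simp
    finally have ev1: "\<forall>\<^sub>F n in sequentially. (\<Sum>j\<le>A. b j * (g (n - j) / g (Suc n) * B
        + \<bar>L\<bar> * \<bar>g (n - j) / g (Suc n) - 1\<bar>)) < d * B + \<delta>"
      by (rule order_tendstoD(2)[OF S1])
    have b\<beta>j: "(\<lambda>n. b (n - j) / g (Suc n)) \<longlonglongrightarrow> \<beta>" for j
    proof -
      have "(\<lambda>n. b (n - j) / g (n - j)) \<longlonglongrightarrow> \<beta>"
        by (rule LIMSEQ_offset[where k = j]) (simp add: b\<beta>)
      from tendsto_mult[OF this \<gamma>[of j]] pos show ?thesis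
        by (simp add: less_imp_neq[THEN not_sym])
    qed
    have S3: "(\<lambda>n. \<Sum>i\<le>A. r i * (b (n - i) / g (Suc n))) \<longlonglongrightarrow> (\<Sum>i\<le>A. r i * \<beta>)"
      by (intro tendsto_intros b\<beta>j)
    then have ev3: "\<forall>\<^sub>F n in sequentially. \<bar>(\<Sum>i\<le>A. r i * (b (n - i) / g (Suc n))) - \<beta> * (\<Sum>i\<le>A. r i)\<bar> < \<delta>"
      using tendstoD[OF S3 \<delta>] by (simp add: dist_real_def sum_distrib_left mult.commute)
    have ev2: "\<forall>\<^sub>F n in sequentially. g n / g (Suc n) < 2"
      by (rule order_tendstoD(2)[OF ratio]) simp
    have ev4: "\<forall>\<^sub>F n in sequentially. 2 * A + n0 < n" by (rule eventually_gt_at_top)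
    have "\<forall>\<^sub>F n in sequentially. \<bar>q (Suc n) - L\<bar> \<le> d * B + \<epsilon>"
      using ev1 ev2 ev3 ev4 mid
    proof eventually_elim
      case (elim n)
      define \<gamma>n where "\<gamma>n j = g (n - j) / g (Suc n)" for j
      have gS: "0 < g (Suc n)" by (rule pos)
      define s1 where "s1 = (\<Sum>j\<le>A. b j * (q (n - j) * \<gamma>n j))"
      define s2 where "s2 = (\<Sum>j\<in>{A<..<n-A}. b j * r (n - j)) / g (Suc n)"
      define s3 where "s3 = (\<Sum>i\<le>A. r i * (b (n - i) / g (Suc n)))"
      have "q (Suc n) = ((\<Sum>j\<le>A. b j * r (n - j))
     + (\<Sum>j\<in>{A<..<n-A}. b j * r (n - j)) + (\<Sum>i\<le>A. r i * b (n - i))) / g (Suc n)"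
        using convolution_split[of A n b r] elim(4) by (simp add: q_def rec)
      also have "\<dots> = s1 + s2 + s3"
      proof -
        have "(\<Sum>j\<le>A. b j * r (n - j)) / g (Suc n) = s1"
          using pos by (simp add: s1_def q_def \<gamma>n_def sum_divide_distrib less_imp_neq[THEN not_sym])
        moreover have "(\<Sum>i\<le>A. r i * b (n - i)) / g (Suc n) = s3"
          by (simp add: s3_def sum_divide_distrib)
        ultimately show ?thesis by (simp add: s2_def add_divide_distrib)
      qed
      finally have q: "q (Suc n) = s1 + s2 + s3" .
      have "s1 - L * (\<Sum>j\<le>A. b j) = (\<Sum>j\<le>A. b j * (q (n - j) * \<gamma>n j - L))"
        by (simp add: s1_def sum_distrib_left right_diff_distrib sum_subtractf mult.commute)
      also have "\<bar>\<dots>\<bar> \<le> (\<Sum>j\<le>A. \<bar>b j * (q (n - j) * \<gamma>n j - L)\<bar>)" by (rule sum_abs)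
      also have "\<dots> \<le> (\<Sum>j\<le>A. b j * (\<gamma>n j * B + \<bar>L\<bar> * \<bar>\<gamma>n j - 1\<bar>))"
      proof (rule sum_mono)
        fix j assume "j \<in> {..A}"
        have \<gamma>0: "0 \<le> \<gamma>n j" using pos by (simp add: \<gamma>n_def less_imp_le)
        have "q (n - j) * \<gamma>n j - L = \<gamma>n j * (q (n - j) - L) + L * (\<gamma>n j - 1)"
          by (simp add: algebra_simps)
        also have "\<bar>\<dots>\<bar> \<le> \<gamma>n j * \<bar>q (n - j) - L\<bar> + \<bar>L\<bar> * \<bar>\<gamma>n j - 1\<bar>"
          using abs_triangle_ineq[of "\<gamma>n j * (q (n - j) - L)" "L * (\<gamma>n j - 1)"] \<gamma>0
          by (simp add: abs_mult)
        also have "\<dots> \<le> \<gamma>n j * B + \<bar>L\<bar> * \<bar>\<gamma>n j - 1\<bar>"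
          using n0[of "n - j"] elim(4) \<open>j \<in> {..A}\<close> \<gamma>0 by (intro add_right_mono mult_left_mono) auto
        finally show "\<bar>b j * (q (n - j) * \<gamma>n j - L)\<bar> \<le> b j * (\<gamma>n j * B + \<bar>L\<bar> * \<bar>\<gamma>n j - 1\<bar>)"
          using b0[of j] by (simp add: abs_mult mult_left_mono)
      qed
      also have "\<dots> < d * B + \<delta>" using elim(1) by (simp add: \<gamma>n_def)
      finally have 1: "\<bar>s1 - L * (\<Sum>j\<le>A. b j)\<bar> < d * B + \<delta>" .
      have "(\<Sum>j\<in>{A<..<n-A}. b j * r (n - j)) \<le> (\<Sum>j\<in>{A<..<n-A}. (K' * g j) * (K * g (n - j)))"
        using pos K' by (intro sum_mono mult_mono bK K r0) (auto simp: less_imp_le)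
      also have "\<dots> = K' * K * (\<Sum>j\<in>{A<..<n-A}. g j * g (n - j))"
        by (simp add: sum_distrib_left mult_ac)
      also have "\<dots> \<le> K' * K * (\<epsilon>' * g n)"
        using elim(5) K' K by (intro mult_left_mono) auto
      also have "\<dots> \<le> K' * K * (\<epsilon>' * (2 * g (Suc n)))"
        using elim(2) gS K' K \<epsilon>' by (intro mult_left_mono) (auto simp: divide_less_eq)
      also have "\<dots> \<le> K' * (K + 1) * (\<epsilon>' * (2 * g (Suc n)))"
        using gS K' K \<epsilon>' by (intro mult_right_mono mult_left_mono) auto
      also have "\<dots> = (2 * K' * (K + 1) * \<epsilon>') * g (Suc n)" by (simp only: mult_ac)
      also have "2 * K' * (K + 1) * \<epsilon>' = \<delta>"
        using K' K by (simp add: \<epsilon>'_def add_nonneg_eq_0_iff)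
      finally have "s2 \<le> \<delta>" using gS by (simp add: s2_def divide_le_eq)
      moreover have "0 \<le> s2" unfolding s2_def
        using gS b0 r0 by (intro divide_nonneg_nonneg sum_nonneg mult_nonneg_nonneg) auto
      ultimately have 2: "\<bar>s2\<bar> \<le> \<delta>" by simp
      have 3: "\<bar>s3 - \<beta> * (\<Sum>i\<le>A. r i)\<bar> < \<delta>" using elim(3) by (simp add: s3_def)
      \<comment> \<open>Five errors: head block, truncation of the mass of \<open>b\<close>, middle block, last block, truncation of the sum of \<open>r\<close>.\<close>
      have "q (Suc n) - L = (s1 - L * (\<Sum>j\<le>A. b j)) + (L * (\<Sum>j\<le>A. b j) - L * d) + s2
           + (s3 - \<beta> * (\<Sum>i\<le>A. r i)) + (\<beta> * (\<Sum>i\<le>A. r i) - \<beta> * suminf r)"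
        using fixed_point by (simp add: q mult.commute)
      moreover have "\<epsilon> = 5 * \<delta>" by (simp add: \<delta>_def)
      ultimately show ?case using 1 2 3 head tail by linarith
    qed
    then show "\<forall>\<^sub>F n in sequentially. \<bar>q n - L\<bar> \<le> d * B + \<epsilon>"
      by (subst (asm) eventually_sequentially_Suc)
  qed simp
  then have "(\<lambda>n. q n - L) \<longlonglongrightarrow> 0" by (simp add: tendsto_rabs_zero_iff)
  then show ?thesis by (simp add: q_def L_def d_def LIM_zero_iff)
qed

section \<open>Inverses of the constant sequence under convolution\<close>

text \<open>Differencing the identity for \<open>n\<close> and \<open>n + 1\<close> turns the convolution inverse into a renewal equation
  whose step weights are the decrements of \<open>u\<close>; they have total mass \<open>1 - P\<close> if \<open>u\<close> tends to \<open>P\<close>.\<close>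

lemma renewal_recursion:
  fixes u r :: "nat \<Rightarrow> real"
  assumes u0: "u 0 = 1" and conv: "\<And>n. (\<Sum>i\<le>n. u i * r (n - i)) = 1"
  shows "r (Suc n) = (\<Sum>j\<le>n. (u j - u (Suc j)) * r (n - j))"
proof -
  have "r (Suc n) + (\<Sum>j\<le>n. u (Suc j) * r (n - j)) = 1"
    using conv[of "Suc n"] u0 by (subst (asm) sum.atMost_Suc_shift) simp
  then show ?thesis using conv[of n] by (simp add: left_diff_distrib sum_subtractf)
qed

text \<open>Summing the renewal equation gives \<open>R = 1 + (1 - P) * R\<close> for the sum \<open>R\<close> of \<open>r\<close>.\<close>

lemma renewal_sums:
  fixes u r :: "nat \<Rightarrow> real"
  assumes u0: "u 0 = 1" and conv: "\<And>n. (\<Sum>i\<le>n. u i * r (n - i)) = 1"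
    and u: "decseq u" "u \<longlonglongrightarrow> P" "0 < P" and r0: "\<And>n. 0 \<le> r n"
  shows "r sums (1 / P)"
proof -
  have uP: "P \<le> u n" for n using decseq_ge[OF u(1,2)] .
  have summable: "summable r"
  proof (rule summableI_nonneg_bounded[where x = "1 / P"])
    fix n
    have "(\<Sum>i<n. r i) * P \<le> (\<Sum>i\<le>n. r i * P)"
      unfolding sum_distrib_right using r0 u(3) by (intro sum_mono2) auto
    also have "\<dots> \<le> (\<Sum>i\<le>n. r i * u (n - i))" by (intro sum_mono mult_left_mono uP r0)
    also have "\<dots> = (\<Sum>i\<le>n. u i * r (n - i))"
      by (rule sum.reindex_bij_witness[where i = "\<lambda>i. n - i" and j = "\<lambda>i. n - i"]) auto
    finally show "(\<Sum>i<n. r i) \<le> 1 / P" using conv[of n] u(3) by (simp add: le_divide_eq)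
  qed (rule r0)
  have b: "(\<lambda>n. u n - u (Suc n)) sums (1 - P)" using telescope_sums'[OF u(2)] u0 by simp
  have b0: "0 \<le> u n - u (Suc n)" for n using u(1) by (simp add: decseq_Suc_iff)
  have "(\<lambda>n. \<Sum>j\<le>n. (u j - u (Suc j)) * r (n - j)) sums ((1 - P) * suminf r)"
    using Cauchy_product_sums[of "\<lambda>n. u n - u (Suc n)" r] b0 r0 b summable
    by (simp add: sums_iff)
  then have "(\<lambda>n. r (Suc n)) sums ((1 - P) * suminf r)"
    using renewal_recursion[OF u0 conv] by simp
  then have "r sums ((1 - P) * suminf r + r 0)" by (simp add: sums_Suc_iff)
  then have "suminf r = (1 - P) * suminf r + r 0" by (simp add: sums_iff)
  moreover have "r 0 = 1" using conv[of 0] u0 by simp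
  ultimately have "P * suminf r = 1" by (simp add: algebra_simps)
  then have "suminf r = 1 / P" using u(3) by (simp add: field_simps)
  then show ?thesis using summable by (simp add: sums_iff)
qed

section \<open>Tails of strong subexponential distributions\<close>

lemma antimono_borel_measurable:
  fixes g :: "real \<Rightarrow> real"
  assumes "antimono g"
  shows "g \<in> borel_measurable borel"
proof -
  have "(\<lambda>x. - g x) \<in> borel_measurable borel"
    by (rule borel_measurable_mono) (use assms in \<open>auto simp: mono_def antimono_def\<close>)
  then show ?thesis by simp
qed

lemma antimono_set_integrable:
  fixes g :: "real \<Rightarrow> real"
  assumes g: "antimono g" "\<And>x. 0 \<le> g x"
  shows "set_integrable lborel {a..b} g"
  unfolding set_integrable_def
proof (rule integrableI_bounded_set_indicator[where B = "g a"])
  show "g \<in> borel_measurable lborel" using antimono_borel_measurable[OF g(1)] by simp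
  show "AE x in lborel. x \<in> {a..b} \<longrightarrow> norm (g x) \<le> g a"
    using g by (auto simp: antimono_def)
qed (auto simp: emeasure_lborel_Icc_eq)

lemma antimono_convolution_set_integrable:
  fixes g :: "real \<Rightarrow> real"
  assumes g: "antimono g" "\<And>x. 0 \<le> g x"
  shows "set_integrable lborel {a..b} (\<lambda>y. g (x - y) * g y)"
  unfolding set_integrable_def
proof (rule integrableI_bounded_set_indicator[where B = "g (x - b) * g a"])
  show "(\<lambda>y. g (x - y) * g y) \<in> borel_measurable lborel"
    using antimono_borel_measurable[OF g(1)] by measurable
  show "AE y in lborel. y \<in> {a..b} \<longrightarrow> norm (g (x - y) * g y) \<le> g (x - b) * g a"
    using g by (auto simp: antimono_def abs_mult intro!: mult_mono AE_I2)
qed (auto simp: emeasure_lborel_Icc_eq)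

text \<open>Transfers estimates from integrals to sums over integers: the term with index \<open>k\<close> is charged to
  the unit interval that ends at \<open>k\<close>.\<close>

lemma sum_le_set_integral_unit_intervals:
  fixes h :: "real \<Rightarrow> real" and C :: "nat \<Rightarrow> real"
  assumes "finite K" and T: "T \<in> sets lborel" "set_integrable lborel T h" "\<And>y. y \<in> T \<Longrightarrow> 0 \<le> h y"
    and sub: "\<And>k. k \<in> K \<Longrightarrow> {real k - 1<..<real k} \<subseteq> T"
    and le: "\<And>k y. k \<in> K \<Longrightarrow> real k - 1 < y \<Longrightarrow> y < real k \<Longrightarrow> C k \<le> h y"
  shows "(\<Sum>k\<in>K. C k) \<le> (LINT y:T|lborel. h y)"
proof -
  define U where "U k = {real k - 1<..<real k}" for k :: nat
  have int: "set_integrable lborel (U k) h" if "k \<in> K" for k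
    by (rule set_integrable_subset[OF T(2)]) (use sub[OF that] in \<open>auto simp: U_def\<close>)
  have "(\<Sum>k\<in>K. C k) \<le> (\<Sum>k\<in>K. LINT y:U k|lborel. h y)"
  proof (rule sum_mono)
    fix k assume k: "k \<in> K"
    have "C k = (LINT y:U k|lborel. C k)"
      by (simp add: U_def set_integral_const)
    also have "\<dots> \<le> (LINT y:U k|lborel. h y)"
    proof (rule set_integral_mono[OF _ int[OF k]])
      show "set_integrable lborel (U k) (\<lambda>y. C k)"
        by (simp add: set_integrable_def U_def)
    qed (use le k in \<open>auto simp: U_def\<close>)
    finally show "C k \<le> (LINT y:U k|lborel. h y)" .
  qed
  also have "\<dots> = (LINT y:(\<Union>k\<in>K. U k)|lborel. h y)"
  proof (rule set_integral_finite_Union[symmetric, OF \<open>finite K\<close>])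
    have "k = l" if "real k - 1 < y" "y < real k" "real l - 1 < y" "y < real l" for k l :: nat and y
      using that by linarith
    then show "disjoint_family_on U K"
      by (fastforce simp: disjoint_family_on_def U_def)
  qed (use int in \<open>auto simp: U_def\<close>)
  also have "\<dots> \<le> (LINT y:T|lborel. h y)"
    unfolding set_lebesgue_integral_def
  proof (rule integral_mono)
    show "integrable lborel (\<lambda>y. indicator T y *\<^sub>R h y)"
      using T(2) by (simp add: set_integrable_def)
    have "set_integrable lborel (\<Union>k\<in>K. U k) h"
      by (rule set_integrable_subset[OF T(2)]) (use sub \<open>finite K\<close> in \<open>auto simp: U_def\<close>)
    then show "integrable lborel (\<lambda>y. indicator (\<Union>k\<in>K. U k) y *\<^sub>R h y)"
      by (simp add: set_integrable_def)
    show "indicator (\<Union>k\<in>K. U k) y *\<^sub>R h y \<le> indicator T y *\<^sub>R h y" for y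
      using sub T(3) by (fastforce simp: U_def indicator_def)
  qed
  finally show ?thesis .
qed

text \<open>On each of the end blocks \<open>{0..A}\<close> and \<open>{x-A..x}\<close> one factor is at least \<open>g x\<close>, which yields the first
  term. On \<open>{c..c+1}\<close> that factor is even at least \<open>g (x - c)\<close>, and the gain is the second
  term. Since the class of strong subexponential distributions requires the right-hand side to be
  asymptotically twice the whole integral of \<open>g\<close>, times \<open>g x\<close>, both other terms on the left must be
  negligible. This controls long-tailedness and the middle block at the same time.\<close>

lemma tail_convolution_lower_bound:
  fixes g :: "real \<Rightarrow> real"
  assumes g: "antimono g" "\<And>x. 0 \<le> g x" and A: "0 \<le> c" "c + 1 \<le> A" "2 * A < x"
  shows "g x * (2 * (LINT y:{0..A}|lborel. g y)) + (g (x - c) - g x) * (LINT y:{c..c+1}|lborel. g y)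
      + (LINT y:{A<..<x-A}|lborel. g (x - y) * g y)
    \<le> (LINT y:{0..x}|lborel. g (x - y) * g y)"
proof -
  note gint = antimono_set_integrable[OF g, unfolded set_integrable_def]
  \<comment> \<open>Reflection \<open>y \<mapsto> x - y\<close> turns the end block at \<open>x\<close> into the one at 0.\<close>
  have refl_int: "integrable lborel (\<lambda>y. indicator {x-A..x} y *\<^sub>R g (x - y))"
    and refl_eq: "(\<integral>y. indicator {x-A..x} y *\<^sub>R g (x - y) \<partial>lborel) = (LINT y:{0..A}|lborel. g y)"
  proof -
    have ind: "indicator {0..A} (x + - 1 * y) *\<^sub>R g (x + - 1 * y) = indicator {x-A..x} y *\<^sub>R g (x - y)" for y
      by (auto simp: indicator_def)
    show "integrable lborel (\<lambda>y. indicator {x-A..x} y *\<^sub>R g (x - y))"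
      using lborel_integrable_real_affine[OF gint[of 0 A], of "-1" x] unfolding ind by simp
    show "(\<integral>y. indicator {x-A..x} y *\<^sub>R g (x - y) \<partial>lborel) = (LINT y:{0..A}|lborel. g y)"
      using lborel_integral_real_affine[of "-1" "\<lambda>y. indicator {0..A} y *\<^sub>R g y" x] unfolding ind
      by (simp add: set_lebesgue_integral_def)
  qed
  have mid_int: "integrable lborel (\<lambda>y. indicator {A<..<x-A} y *\<^sub>R (g (x - y) * g y))"
    using set_integrable_subset[OF antimono_convolution_set_integrable[OF g, of 0 x x], of "{A<..<x-A}"]
      subsetI[of "{A<..<x-A}" "{0..x}"] A
    by (simp add: set_integrable_def)
  have all_int: "integrable lborel (\<lambda>y. indicator {0..x} y *\<^sub>R (g (x - y) * g y))"
    using antimono_convolution_set_integrable[OF g, of 0 x x] by (simp add: set_integrable_def)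
  have linear: "(\<integral>y. a1 * f1 y + a2 * f2 y + a3 * f3 y + f4 y \<partial>lborel)
      = a1 * (\<integral>y. f1 y \<partial>lborel) + a2 * (\<integral>y. f2 y \<partial>lborel) + a3 * (\<integral>y. f3 y \<partial>lborel) + (\<integral>y. f4 y \<partial>lborel)"
    if "integrable lborel f1" "integrable lborel f2" "integrable lborel f3" "integrable lborel f4"
    for a1 a2 a3 and f1 f2 f3 f4 :: "real \<Rightarrow> real"
    using that by simp
  have "g x * (2 * (LINT y:{0..A}|lborel. g y)) + (g (x - c) - g x) * (LINT y:{c..c+1}|lborel. g y)
      + (LINT y:{A<..<x-A}|lborel. g (x - y) * g y)
     = (\<integral>y. g x * (indicator {0..A} y *\<^sub>R g y) + g x * (indicator {x-A..x} y *\<^sub>R g (x - y))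
        + (g (x - c) - g x) * (indicator {c..c+1} y *\<^sub>R g y)
        + indicator {A<..<x-A} y *\<^sub>R (g (x - y) * g y) \<partial>lborel)"
    using linear[OF gint[of 0 A] refl_int gint[of c "c + 1"] mid_int, of "g x" "g x" "g (x - c) - g x"] refl_eq
    by (simp add: set_lebesgue_integral_def)
  also have "\<dots> \<le> (\<integral>y. indicator {0..x} y *\<^sub>R (g (x - y) * g y) \<partial>lborel)"
  proof (rule integral_mono)
    fix y
    have mono: "s \<le> t \<Longrightarrow> g t * g u \<le> g s * g u" for s t u
      using g by (auto simp: antimono_def intro!: mult_right_mono)
    show "g x * (indicator {0..A} y *\<^sub>R g y) + g x * (indicator {x-A..x} y *\<^sub>R g (x - y))
        + (g (x - c) - g x) * (indicator {c..c+1} y *\<^sub>R g y)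
        + indicator {A<..<x-A} y *\<^sub>R (g (x - y) * g y) \<le> indicator {0..x} y *\<^sub>R (g (x - y) * g y)"
      using A mono[of "x - y" x y] mono[of y x "x - y"] mono[of "x - y" "x - c" y]
      by (auto simp: indicator_def algebra_simps)
  qed (intro Bochner_Integration.integrable_add integrable_mult_right refl_int mid_int gint all_int)+
  finally show ?thesis by (simp add: set_lebesgue_integral_def)
qed

locale S_star_tail =
  fixes g :: "real \<Rightarrow> real"
  assumes antimono: "antimono g" and pos: "\<And>x. 0 < g x"
    and integrable: "set_integrable lborel {0..} g"
    and convolution: "((\<lambda>x. (LINT y:{0..x}|lborel. g (x - y) * g y) / g x)
        \<longlongrightarrow> 2 * (LINT y:{0..}|lborel. g y)) at_top"
begin

lemma nonneg: "0 \<le> g x" using pos[of x] by simp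

text \<open>The convolution ratio tends to \<open>2 * \<mu>\<close>, and the end blocks already account for almost \<open>2 * \<mu>\<close> if
  \<open>A\<close> is large.\<close>

lemma convolution_excess_small:
  assumes "0 < \<epsilon>" "0 \<le> c"
  shows "\<exists>A::nat. c + 1 \<le> real A \<and> (\<forall>\<^sub>F x in at_top.
     (g (x - c) / g x - 1) * (LINT y:{c..c+1}|lborel. g y)
       + (LINT y:{real A<..<x - real A}|lborel. g (x - y) * g y) / g x < \<epsilon>)"
proof -
  let ?\<mu> = "LINT y:{0..}|lborel. g y"
  have "((\<lambda>A. \<integral>y. indicator {..A} y *\<^sub>R (indicator {0..} y *\<^sub>R g y) \<partial>lborel) \<longlongrightarrow> ?\<mu>) at_top"
    unfolding set_lebesgue_integral_def
    by (rule tendsto_integral_at_top) (use integrable in \<open>auto simp: set_integrable_def\<close>)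
  moreover have "indicator {..A} y *\<^sub>R (indicator {0..} y *\<^sub>R g y) = indicator {0..A} y *\<^sub>R g y"
    for A y :: real by (auto simp: indicator_def)
  ultimately have "((\<lambda>A. LINT y:{0..A}|lborel. g y) \<longlongrightarrow> ?\<mu>) at_top"
    by (simp only: set_lebesgue_integral_def)
  then have "(\<lambda>A. LINT y:{0..real A}|lborel. g y) \<longlonglongrightarrow> ?\<mu>"
    by (rule filterlim_compose[OF _ filterlim_real_sequentially])
  then have "\<forall>\<^sub>F A in sequentially. ?\<mu> - \<epsilon> / 4 < (LINT y:{0..real A}|lborel. g y)"
    by (rule order_tendstoD(1)) (use assms in simp)
  moreover have "\<forall>\<^sub>F A in sequentially. nat \<lceil>c + 1\<rceil> \<le> A" by (rule eventually_ge_at_top)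
  ultimately have "\<forall>\<^sub>F A in sequentially. ?\<mu> - \<epsilon> / 4 < (LINT y:{0..real A}|lborel. g y) \<and> c + 1 \<le> real A"
    by eventually_elim linarith
  then obtain A :: nat where A: "?\<mu> - \<epsilon> / 4 < (LINT y:{0..real A}|lborel. g y)" "c + 1 \<le> real A"
    by (auto simp: eventually_sequentially)
  have "\<forall>\<^sub>F x in at_top. (LINT y:{0..x}|lborel. g (x - y) * g y) / g x < 2 * ?\<mu> + \<epsilon> / 2"
    by (rule order_tendstoD(2)[OF convolution]) (use assms in simp)
  moreover have "\<forall>\<^sub>F x in at_top. 2 * real A < x" by (rule eventually_gt_at_top)
  ultimately have "\<forall>\<^sub>F x in at_top.
     (g (x - c) / g x - 1) * (LINT y:{c..c+1}|lborel. g y)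
       + (LINT y:{real A<..<x - real A}|lborel. g (x - y) * g y) / g x < \<epsilon>"
  proof eventually_elim
    case (elim x)
    let ?I = "LINT y:{0..real A}|lborel. g y" and ?J = "LINT y:{c..c+1}|lborel. g y"
      and ?M = "LINT y:{real A<..<x - real A}|lborel. g (x - y) * g y"
    from tail_convolution_lower_bound[OF antimono nonneg assms(2) A(2) elim(2)]
    have "(g x * (2 * ?I) + (g (x - c) - g x) * ?J + ?M) / g x
        \<le> (LINT y:{0..x}|lborel. g (x - y) * g y) / g x"
      using nonneg[of x] by (rule divide_right_mono)
    also have "(g x * (2 * ?I) + (g (x - c) - g x) * ?J + ?M) / g x
        = 2 * ?I + (g (x - c) / g x - 1) * ?J + ?M / g x"
      using pos[of x] by (simp add: field_simps)
    finally show ?case using elim(1) A(1) by simp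
  qed
  with A show ?thesis by blast
qed

lemma convolution_middle_nonneg:
  "0 \<le> (LINT y:T|lborel. g (x - y) * g y)"
  unfolding set_lebesgue_integral_def
  by (intro Bochner_Integration.integral_nonneg) (auto simp: nonneg indicator_def)

lemma long_tailed_nonneg:
  assumes "0 \<le> c"
  shows "((\<lambda>x. g (x - c) / g x) \<longlongrightarrow> 1) at_top"
proof (rule order_tendstoI)
  have ge: "1 \<le> g (x - c) / g x" for x
    using antimonoD[OF antimono, of "x - c" x] assms pos[of x] by (simp add: le_divide_eq)
  show "\<forall>\<^sub>F x in at_top. a < g (x - c) / g x" if "a < 1" for a
    by (rule always_eventually) (use that ge in \<open>auto intro: less_le_trans\<close>)
  fix a :: real assume a: "1 < a"
  let ?J = "LINT y:{c..c+1}|lborel. g y"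
  have "g (c + 1) = (LINT y:{c..c+1}|lborel. g (c + 1))" by (simp add: set_integral_const)
  also have "\<dots> \<le> ?J"
    by (intro set_integral_mono antimono_set_integrable[OF antimono nonneg])
      (auto simp: antimonoD[OF antimono] set_integrable_def)
  finally have J: "0 < ?J" using pos[of "c + 1"] by simp
  then obtain A :: nat where "\<forall>\<^sub>F x in at_top. (g (x - c) / g x - 1) * ?J
       + (LINT y:{real A<..<x - real A}|lborel. g (x - y) * g y) / g x < (a - 1) * ?J"
    using convolution_excess_small[of "(a - 1) * ?J" c] a assms by auto
  then show "\<forall>\<^sub>F x in at_top. g (x - c) / g x < a"
  proof eventually_elim
    case (elim x)
    have "0 \<le> (LINT y:{real A<..<x - real A}|lborel. g (x - y) * g y) / g x"
      using convolution_middle_nonneg nonneg by simp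
    with elim have "(g (x - c) / g x - 1) * ?J < (a - 1) * ?J" by simp
    with J show ?case by simp
  qed
qed

lemma long_tailed: "((\<lambda>x. g (x + c) / g x) \<longlongrightarrow> 1) at_top"
proof (cases "c \<le> 0")
  case True
  then show ?thesis using long_tailed_nonneg[of "- c"] by simp
next
  case False
  then have "((\<lambda>x. g (x - c) / g x) \<longlongrightarrow> 1) at_top" by (intro long_tailed_nonneg) simp
  then have "((\<lambda>x. g (x + c - c) / g (x + c)) \<longlongrightarrow> 1) at_top"
    by (rule filterlim_compose) (rule filterlim_tendsto_add_at_top[OF tendsto_const filterlim_ident, of c, simplified add.commute])
  then have "((\<lambda>x. inverse (g (x + c - c) / g (x + c))) \<longlongrightarrow> inverse 1) at_top"
    by (rule tendsto_inverse) simp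
  then show ?thesis by simp
qed

text \<open>The indices of a product \<open>g i * g (n + 1 - i)\<close> add up to \<open>n + 1\<close>, and rounding to integers loses at most
  one unit in total. The sum is therefore compared with the convolution integral at \<open>n\<close>, and the
  ratio condition returns from \<open>n\<close> to \<open>n + 1\<close>.\<close>

lemma discrete_subexp_tail: "discrete_subexp (\<lambda>n. g (real n))"
  unfolding discrete_subexp_def
proof (intro conjI allI impI)
  show "0 < g (real n)" for n by (rule pos)
  show "decseq (\<lambda>n. g (real n))" using antimono by (auto simp: decseq_def antimono_def)
  have "((\<lambda>x. g (x - 1) / g x) \<longlongrightarrow> 1) at_top" by (rule long_tailed_nonneg) simp
  then have "(\<lambda>n. g (real n - 1) / g (real n)) \<longlonglongrightarrow> 1"
    by (rule filterlim_compose[OF _ filterlim_real_sequentially])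
  from LIMSEQ_Suc[OF this] show ratio: "(\<lambda>n. g (real n) / g (real (Suc n))) \<longlonglongrightarrow> 1" by simp
  fix \<epsilon> :: real assume "0 < \<epsilon>"
  then obtain A :: nat where "\<forall>\<^sub>F x in at_top. (g (x - 0) / g x - 1) * (LINT y:{0..0+1}|lborel. g y)
       + (LINT y:{real A<..<x - real A}|lborel. g (x - y) * g y) / g x < \<epsilon> / 2"
    using convolution_excess_small[of "\<epsilon> / 2" 0] by auto
  then have "\<forall>\<^sub>F x in at_top. (LINT y:{real A<..<x - real A}|lborel. g (x - y) * g y) < \<epsilon> / 2 * g x"
  proof eventually_elim
    case (elim x)
    then show ?case using pos[of x] by (simp add: divide_less_eq)
  qed
  then have "\<forall>\<^sub>F n in sequentially. (LINT y:{real A<..<real n - real A}|lborel. g (real n - y) * g y)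
      < \<epsilon> / 2 * g (real n)"
    by (rule eventually_compose_filterlim[OF _ filterlim_real_sequentially])
  moreover have "\<forall>\<^sub>F n in sequentially. g (real n) / g (real (Suc n)) < 2"
    by (rule order_tendstoD(2)[OF ratio]) simp
  ultimately have "\<forall>\<^sub>F n in sequentially. (\<Sum>i\<in>{A<..<Suc n-A}. g (real i) * g (real (Suc n - i)))
      \<le> \<epsilon> * g (real (Suc n))"
  proof eventually_elim
    case (elim n)
    have "(\<Sum>i\<in>{A<..<Suc n-A}. g (real i) * g (real (Suc n - i)))
       \<le> (LINT y:{real A<..<real n - real A}|lborel. g (real n - y) * g y)"
    proof (rule sum_le_set_integral_unit_intervals)
      show "set_integrable lborel {real A<..<real n - real A} (\<lambda>y. g (real n - y) * g y)"
        by (rule set_integrable_subset[OF antimono_convolution_set_integrable[OF antimono nonneg,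
              of "real A" "real n - real A"]]) auto
      show "{real k - 1<..<real k} \<subseteq> {real A<..<real n - real A}" if "k \<in> {A<..<Suc n-A}" for k
      proof -
        from that have "A + 1 \<le> k" "k + A \<le> n" by auto
        then have "real A + 1 \<le> real k" "real k + real A \<le> real n" by linarith+
        then show ?thesis by auto
      qed
      fix k y assume k: "k \<in> {A<..<Suc n-A}" and y: "real k - 1 < y" "y < real k"
      then have "real (Suc n - k) = real n + 1 - real k" by auto
      then have "g (real (Suc n - k)) \<le> g (real n - y)"
        using y by (intro antimonoD[OF antimono]) simp
      moreover have "g (real k) \<le> g y" using y by (intro antimonoD[OF antimono]) simp
      ultimately show "g (real k) * g (real (Suc n - k)) \<le> g (real n - y) * g y"
        using nonneg by (subst mult.commute) (intro mult_mono)
    qed (auto simp: nonneg)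
    also have "\<dots> < \<epsilon> / 2 * g (real n)" by (rule elim)
    also have "\<dots> \<le> \<epsilon> / 2 * (2 * g (real (Suc n)))"
      using elim(2) pos[of "real (Suc n)"] \<open>0 < \<epsilon>\<close>
      by (intro mult_left_mono) (auto simp: divide_less_eq)
    finally show ?case by simp
  qed
  then have "\<forall>\<^sub>F n in sequentially. (\<Sum>i\<in>{A<..<n-A}. g (real i) * g (real (n - i))) \<le> \<epsilon> * g (real n)"
    by (subst (asm) eventually_sequentially_Suc)
  then show "\<exists>A. \<forall>\<^sub>F n in sequentially. (\<Sum>i\<in>{A<..<n-A}. g (real i) * g (real (n - i))) \<le> \<epsilon> * g (real n)"
    by blast
qed

lemma summable_tail: "summable (\<lambda>n. g (real n))"
proof -
  have "summable (\<lambda>n. g (real (Suc n)))"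
  proof (rule summableI_nonneg_bounded[where x = "LINT y:{0..}|lborel. g y"])
    show "(\<Sum>i<n. g (real (Suc i))) \<le> (LINT y:{0..}|lborel. g y)" for n
    proof -
      have "(\<Sum>i<n. g (real (Suc i))) = (\<Sum>k\<in>{1..n}. g (real k))"
        by (rule sum.reindex_bij_witness[where i = "\<lambda>k. k - 1" and j = Suc]) auto
      also have "\<dots> \<le> (LINT y:{0..}|lborel. g y)"
        by (rule sum_le_set_integral_unit_intervals)
          (auto simp: integrable nonneg intro!: antimonoD[OF antimono])
      finally show ?thesis .
    qed
  qed (rule nonneg)
  then show ?thesis by (subst (asm) summable_Suc_iff)
qed

lemma tail_shift_tendsto: "(\<lambda>n. g (c + real n) / g (real n)) \<longlonglongrightarrow> 1"
  using filterlim_compose[OF long_tailed[of c] filterlim_real_sequentially]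
  by (simp add: add.commute)

lemma summable_tail_shift: "summable (\<lambda>n. g (c + real n))"
proof (rule summable_comparison_test_ev)
  have "\<forall>\<^sub>F n in sequentially. g (c + real n) / g (real n) < 2"
    by (rule order_tendstoD(2)[OF tail_shift_tendsto]) simp
  then show "\<forall>\<^sub>F n in sequentially. norm (g (c + real n)) \<le> 2 * g (real n)"
    by eventually_elim (use pos nonneg in \<open>auto simp: divide_less_eq less_imp_le\<close>)
  show "summable (\<lambda>n. 2 * g (real n))" by (intro summable_mult summable_tail)
qed

end

lemma S_star_imp_tail:
  assumes "F \<in> S_star"
  shows "S_star_tail (\<lambda>y. 1 - F y)"
proof
  from assms obtain D where D: "real_distribution D" "F = cdf D"
    unfolding S_star_def is_distribution_function_def by blast
  then interpret real_distribution D by simp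
  show "antimono (\<lambda>y. 1 - F y)" by (auto simp: antimono_def D(2) cdf_nondecreasing)
qed (use assms in \<open>simp_all add: S_star_def\<close>)

section \<open>Last-visit decomposition of the chain\<close>

text \<open>The chain at time \<open>k\<close> is the maximum of \<open>x - k\<close> and the innovations, each lowered by its age.\<close>

lemma max_chain_le_iff:
  "max_chain \<eta> x k \<omega> \<le> y \<longleftrightarrow> x - real k \<le> y \<and> (\<forall>j\<in>{0<..k}. \<eta> j \<omega> \<le> y + real (k - j))"
proof (induction k arbitrary: y)
  case 0
  then show ?case by simp
next
  case (Suc k)
  have set: "{0<..Suc k} = insert (Suc k) {0<..k}" by auto
  have "max_chain \<eta> x (Suc k) \<omega> \<le> y \<longleftrightarrow> max_chain \<eta> x k \<omega> \<le> y + 1 \<and> \<eta> (Suc k) \<omega> \<le> y"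
    by auto
  also have "\<dots> \<longleftrightarrow> x - real k \<le> y + 1 \<and> (\<forall>j\<in>{0<..k}. \<eta> j \<omega> \<le> y + 1 + real (k - j)) \<and> \<eta> (Suc k) \<omega> \<le> y"
    unfolding Suc.IH by simp
  also have "(\<forall>j\<in>{0<..k}. \<eta> j \<omega> \<le> y + 1 + real (k - j)) \<longleftrightarrow> (\<forall>j\<in>{0<..k}. \<eta> j \<omega> \<le> y + real (Suc k - j))"
    by (intro ball_cong refl) (auto simp: Suc_diff_le)
  finally show ?case unfolding set by (auto simp: algebra_simps)
qed

lemma hitting_time_gt_iff:
  "enat m < hitting_time \<eta> x0 x \<omega> \<longleftrightarrow> (\<forall>k\<in>{1..m}. x0 < max_chain \<eta> x k \<omega>)"
proof -
  let ?S = "{enat k |k. k \<ge> 1 \<and> max_chain \<eta> x k \<omega> \<le> x0}"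
  have "enat m < hitting_time \<eta> x0 x \<omega> \<longleftrightarrow> enat (Suc m) \<le> Inf ?S"
    unfolding hitting_time_def by (simp add: Suc_ile_eq)
  also have "\<dots> \<longleftrightarrow> (\<forall>k. 1 \<le> k \<and> max_chain \<eta> x k \<omega> \<le> x0 \<longrightarrow> Suc m \<le> k)"
    by (auto simp: le_Inf_iff)
  also have "\<dots> \<longleftrightarrow> (\<forall>k\<in>{1..m}. x0 < max_chain \<eta> x k \<omega>)"
    by (metis atLeastAtMost_iff not_less Suc_le_eq)
  finally show ?thesis .
qed

locale max_chain_model = prob_space M for M :: "'a measure" +
  fixes \<eta> :: "nat \<Rightarrow> 'a \<Rightarrow> real" and x0 :: real
  assumes indep: "indep_vars (\<lambda>_. borel) \<eta> {1..}"
    and ident: "\<And>n. n \<ge> 1 \<Longrightarrow> distr M borel (\<eta> n) = distr M borel (\<eta> 1)"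
begin

text \<open>The chain that is at or below \<open>x0\<close> at time \<open>k\<close> is at or below \<open>x0\<close> at time \<open>l\<close> exactly on this event:
  its value at time \<open>k\<close> no longer matters, only the innovations after \<open>k\<close> do. Visits to the half-line
  below \<open>x0\<close> are thus renewals.\<close>

definition visit :: "nat \<Rightarrow> nat \<Rightarrow> 'a \<Rightarrow> bool" where
  "visit k l \<omega> \<longleftrightarrow> (\<forall>j\<in>{k<..l}. \<eta> j \<omega> \<le> x0 + real (l - j))"

definition avoid :: "nat \<Rightarrow> nat \<Rightarrow> 'a \<Rightarrow> bool" where
  "avoid k m \<omega> \<longleftrightarrow> (\<forall>l\<in>{k<..m}. \<not> visit k l \<omega>)"

definition level_prob :: "nat \<Rightarrow> real" where
  "level_prob i = prob {\<omega>\<in>space M. \<eta> 1 \<omega> \<le> x0 + real i}"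

definition visit_prob :: "nat \<Rightarrow> real" where
  "visit_prob i = (\<Prod>j<i. level_prob j)"

text \<open>The tail of the hitting time for a start in \<open>(x0, x0 + 1]\<close>, or equally of the time between
  consecutive visits.\<close>

definition avoid_prob :: "nat \<Rightarrow> real" where
  "avoid_prob s = prob {\<omega>\<in>space M. avoid 0 s \<omega>}"

lemma rv: "1 \<le> j \<Longrightarrow> random_variable borel (\<eta> j)"
  using indep unfolding indep_vars_def by auto

lemma visit_event [measurable]: "{\<omega>\<in>space M. visit k l \<omega>} \<in> events"
  unfolding visit_def by (intro sets.sets_Collect_finite_All borel_measurable_const borel_measurable_le rv) auto

lemma avoid_event [measurable]: "{\<omega>\<in>space M. avoid k m \<omega>} \<in> events"
  unfolding avoid_def by measurable

lemma prob_le_eq: "1 \<le> n \<Longrightarrow> prob {\<omega>\<in>space M. \<eta> n \<omega> \<le> y} = prob {\<omega>\<in>space M. \<eta> 1 \<omega> \<le> y}"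
proof -
  have "measure (distr M borel (\<eta> n)) {..y} = prob {\<omega>\<in>space M. \<eta> n \<omega> \<le> y}" if "1 \<le> n" for n
    using rv[OF that] by (simp add: measure_distr vimage_def Int_def conj_commute)
  from this[of n] this[of 1] show "1 \<le> n \<Longrightarrow> ?thesis" using ident[of n] by simp
qed

lemma prob_visit:
  assumes "k \<le> l"
  shows "prob {\<omega>\<in>space M. visit k l \<omega>} = visit_prob (l - k)"
proof (cases "k = l")
  case True
  then show ?thesis by (simp add: visit_def visit_prob_def prob_space)
next
  case False
  then have ne: "{k<..l} \<noteq> {}" using assms by auto
  have "{\<omega>\<in>space M. visit k l \<omega>} = (\<Inter>j\<in>{k<..l}. \<eta> j -` {..x0 + real (l - j)} \<inter> space M)"
    using ne by (auto simp: visit_def)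
  also have "prob \<dots> = (\<Prod>j\<in>{k<..l}. prob (\<eta> j -` {..x0 + real (l - j)} \<inter> space M))"
    by (rule indep_varsD[OF indep ne]) auto
  also have "\<dots> = (\<Prod>j\<in>{k<..l}. level_prob (l - j))"
  proof (rule prod.cong[OF refl])
    fix j assume "j \<in> {k<..l}"
    then show "prob (\<eta> j -` {..x0 + real (l - j)} \<inter> space M) = level_prob (l - j)"
      using prob_le_eq[of j "x0 + real (l - j)"]
      by (simp add: level_prob_def vimage_def Int_def conj_commute)
  qed
  also have "\<dots> = (\<Prod>i<l - k. level_prob i)"
    by (rule prod.reindex_bij_witness[where i = "\<lambda>i. l - i" and j = "\<lambda>j. l - j"]) auto
  finally show ?thesis by (simp add: visit_prob_def)
qed

text \<open>The two events depend on disjoint blocks of innovations.\<close>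

lemma prob_visit_avoid:
  "prob {\<omega>\<in>space M. visit k l \<omega> \<and> avoid l m \<omega>}
     = prob {\<omega>\<in>space M. visit k l \<omega>} * prob {\<omega>\<in>space M. avoid l m \<omega>}"
proof -
  let ?P = "\<lambda>I. PiM I (\<lambda>_. borel :: real measure)"
  define V where "V = {f \<in> space (?P {k<..l}). \<forall>j\<in>{k<..l}. f j \<le> x0 + real (l - j)}"
  define W where "W = {f \<in> space (?P {l<..m}). \<forall>p\<in>{l<..m}. \<not> (\<forall>j\<in>{l<..p}. f j \<le> x0 + real (p - j))}"
  have V: "V \<in> sets (?P {k<..l})"
    unfolding V_def by (intro sets.sets_Collect_finite_All borel_measurable_const borel_measurable_le measurable_component_singleton) auto
  have W: "W \<in> sets (?P {l<..m})"
    unfolding W_def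
    by (intro sets.sets_Collect_finite_All borel_measurable_const sets.sets_Collect_neg borel_measurable_le measurable_component_singleton) auto
  have ind: "indep_var (?P {k<..l}) (\<lambda>\<omega>. restrict (\<lambda>i. \<eta> i \<omega>) {k<..l})
      (?P {l<..m}) (\<lambda>\<omega>. restrict (\<lambda>i. \<eta> i \<omega>) {l<..m})"
    by (rule indep_var_restrict[OF indep]) auto
  have v: "(\<lambda>\<omega>. restrict (\<lambda>i. \<eta> i \<omega>) {k<..l}) -` V \<inter> space M = {\<omega>\<in>space M. visit k l \<omega>}"
    by (auto simp: V_def visit_def space_PiM)
  have w: "(\<lambda>\<omega>. restrict (\<lambda>i. \<eta> i \<omega>) {l<..m}) -` W \<inter> space M = {\<omega>\<in>space M. avoid l m \<omega>}"
    by (fastforce simp: W_def avoid_def visit_def space_PiM)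
  have "{\<omega>\<in>space M. visit k l \<omega> \<and> avoid l m \<omega>}
      = (\<lambda>\<omega>. (restrict (\<lambda>i. \<eta> i \<omega>) {k<..l}, restrict (\<lambda>i. \<eta> i \<omega>) {l<..m})) -` (V \<times> W) \<inter> space M"
    using v w by blast
  then show ?thesis using indep_varD[OF ind V W] v w by simp
qed

lemma visit_trans:
  assumes "visit k l \<omega>" "visit l m \<omega>" "l \<le> m"
  shows "visit k m \<omega>"
  unfolding visit_def
proof
  fix j assume j: "j \<in> {k<..m}"
  show "\<eta> j \<omega> \<le> x0 + real (m - j)"
  proof (cases "j \<le> l")
    case True
    then have "\<eta> j \<omega> \<le> x0 + real (l - j)" using assms(1) j by (auto simp: visit_def)
    also have "\<dots> \<le> x0 + real (m - j)" using assms(3) by simp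
    finally show ?thesis .
  next
    case False
    then show ?thesis using assms(2) j by (auto simp: visit_def)
  qed
qed

lemma visit_later: "visit k m \<omega> \<Longrightarrow> k \<le> l \<Longrightarrow> visit l m \<omega>"
  by (auto simp: visit_def)

text \<open>Decomposition according to the last visit in the time window.\<close>

lemma prob_some_visit:
  assumes "k \<le> p"
  shows "prob {\<omega>\<in>space M. \<exists>l\<in>{p..m}. visit k l \<omega>}
    = (\<Sum>l\<in>{p..m}. visit_prob (l - k) * prob {\<omega>\<in>space M. avoid l m \<omega>})"
proof -
  define E where "E l = {\<omega>\<in>space M. visit k l \<omega> \<and> avoid l m \<omega>}" for l
  have "{\<omega>\<in>space M. \<exists>l\<in>{p..m}. visit k l \<omega>} = (\<Union>l\<in>{p..m}. E l)"
  proof (intro equalityI subsetI)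
    fix \<omega> assume "\<omega> \<in> {\<omega>\<in>space M. \<exists>l\<in>{p..m}. visit k l \<omega>}"
    then have \<omega>: "\<omega> \<in> space M" and ne: "{l\<in>{p..m}. visit k l \<omega>} \<noteq> {}" by auto
    define l where "l = Max {l\<in>{p..m}. visit k l \<omega>}"
    have l: "l \<in> {l\<in>{p..m}. visit k l \<omega>}" unfolding l_def using ne by (intro Max_in) auto
    have "\<not> visit l q \<omega>" if "q \<in> {l<..m}" for q
    proof
      assume "visit l q \<omega>"
      then have "visit k q \<omega>" using visit_trans[of k l \<omega> q] l that by auto
      then have "q \<le> l" unfolding l_def using l that by (intro Max_ge) auto
      with that show False by simp
    qed
    then show "\<omega> \<in> (\<Union>l\<in>{p..m}. E l)" using l \<omega> by (auto simp: E_def avoid_def)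
  qed (auto simp: E_def)
  also have "prob \<dots> = (\<Sum>l\<in>{p..m}. prob (E l))"
  proof (rule finite_measure_finite_Union)
    have "E l \<inter> E q = {}" if "l \<in> {p..m}" "q \<in> {p..m}" "l < q" for l q
      using that assms visit_later[of k q _ l] by (fastforce simp: E_def avoid_def)
    then show "disjoint_family_on E {p..m}"
      unfolding disjoint_family_on_def by (metis Int_commute linorder_neqE_nat)
  qed (auto simp: E_def)
  also have "\<dots> = (\<Sum>l\<in>{p..m}. visit_prob (l - k) * prob {\<omega>\<in>space M. avoid l m \<omega>})"
    using assms by (intro sum.cong refl) (simp add: E_def prob_visit_avoid prob_visit)
  finally show ?thesis .
qed

lemma last_visit_decomposition:
  "(\<Sum>i\<le>s. visit_prob i * prob {\<omega>\<in>space M. avoid (k + i) (k + s) \<omega>}) = 1"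
proof -
  have "{\<omega>\<in>space M. \<exists>l\<in>{k..k + s}. visit k l \<omega>} = space M"
    by (auto simp: visit_def intro!: bexI[of _ k])
  then have "1 = (\<Sum>l\<in>{k..k + s}. visit_prob (l - k) * prob {\<omega>\<in>space M. avoid l (k + s) \<omega>})"
    using prob_some_visit[of k k "k + s"] by (simp add: prob_space)
  also have "\<dots> = (\<Sum>i\<le>s. visit_prob i * prob {\<omega>\<in>space M. avoid (k + i) (k + s) \<omega>})"
    by (rule sum.reindex_bij_witness[where i = "\<lambda>i. k + i" and j = "\<lambda>l. l - k"]) auto
  finally show ?thesis by simp
qed

text \<open>Invariance under a shift of time. Instead of comparing joint distributions of shifted blocks, it
  suffices that the last-visit identity determines these probabilities recursively and that its
  coefficients depend on time differences only.\<close>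

lemma prob_avoid: "prob {\<omega>\<in>space M. avoid k (k + s) \<omega>} = avoid_prob s"
proof (induction s arbitrary: k rule: less_induct)
  case (less s)
  have eq: "prob {\<omega>\<in>space M. avoid k (k + s) \<omega>} = 1 - (\<Sum>i\<in>{1..s}. visit_prob i * avoid_prob (s - i))" for k
  proof -
    have "{..s} = insert 0 {1..s}" by auto
    then have "1 = prob {\<omega>\<in>space M. avoid k (k + s) \<omega>}
        + (\<Sum>i\<in>{1..s}. visit_prob i * prob {\<omega>\<in>space M. avoid (k + i) (k + s) \<omega>})"
      using last_visit_decomposition[of k s] by (simp add: visit_prob_def)
    also have "(\<Sum>i\<in>{1..s}. visit_prob i * prob {\<omega>\<in>space M. avoid (k + i) (k + s) \<omega>})
        = (\<Sum>i\<in>{1..s}. visit_prob i * avoid_prob (s - i))"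
    proof (intro sum.cong refl)
      fix i assume "i \<in> {1..s}"
      then show "visit_prob i * prob {\<omega>\<in>space M. avoid (k + i) (k + s) \<omega>} = visit_prob i * avoid_prob (s - i)"
        using less[of "s - i" "k + i"] by simp
    qed
    finally show ?thesis by simp
  qed
  show ?case using eq[of k] eq[of 0] by (simp add: avoid_prob_def)
qed

lemma visit_avoid_convolution: "(\<Sum>i\<le>s. visit_prob i * avoid_prob (s - i)) = 1"
proof -
  have "(\<Sum>i\<le>s. visit_prob i * avoid_prob (s - i))
      = (\<Sum>i\<le>s. visit_prob i * prob {\<omega>\<in>space M. avoid (0 + i) (0 + s) \<omega>})"
  proof (intro sum.cong refl)
    fix i assume "i \<in> {..s}"
    then show "visit_prob i * avoid_prob (s - i) = visit_prob i * prob {\<omega>\<in>space M. avoid (0 + i) (0 + s) \<omega>}"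
      using prob_avoid[of i "s - i"] by simp
  qed
  then show ?thesis using last_visit_decomposition[of 0 s] by simp
qed

text \<open>Up to time \<open>n\<close> the initial value alone keeps the chain above \<open>x0\<close>; from time \<open>n + 1\<close> on it has no influence
  on whether the chain is above \<open>x0\<close>.\<close>

lemma hitting_time_gt_iff_no_visit:
  assumes "x0 + real n < x" "x \<le> x0 + real n + 1"
  shows "enat m < hitting_time \<eta> x0 x \<omega> \<longleftrightarrow> \<not> (\<exists>l\<in>{Suc n..m}. visit 0 l \<omega>)"
proof -
  have "max_chain \<eta> x k \<omega> \<le> x0 \<longleftrightarrow> Suc n \<le> k \<and> visit 0 k \<omega>" for k
  proof -
    have "x - real k \<le> x0 \<longleftrightarrow> Suc n \<le> k"
    proof
      assume "x - real k \<le> x0"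
      then have "real n < real k" using assms by linarith
      then show "Suc n \<le> k" by simp
    next
      assume "Suc n \<le> k"
      then have "real n + 1 \<le> real k" by linarith
      then show "x - real k \<le> x0" using assms by linarith
    qed
    then show ?thesis by (simp add: max_chain_le_iff visit_def)
  qed
  then have "(\<forall>k\<in>{1..m}. x0 < max_chain \<eta> x k \<omega>) \<longleftrightarrow> (\<forall>k\<in>{1..m}. \<not> (Suc n \<le> k \<and> visit 0 k \<omega>))"
    by (simp add: not_le[symmetric])
  then show ?thesis unfolding hitting_time_gt_iff by auto
qed

lemma hitting_time_gt_event:
  assumes "x0 + real n < x" "x \<le> x0 + real n + 1"
  shows "{\<omega>\<in>space M. enat m < hitting_time \<eta> x0 x \<omega>} \<in> events"
  unfolding hitting_time_gt_iff_no_visit[OF assms] by measurable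

text \<open>The last-visit identity over the whole window \<open>{0..m}\<close> has total 1, and the visits at times above \<open>n\<close>
  account for the complementary event. What remains are the terms with \<open>l \<le> n\<close>.\<close>

lemma prob_hitting_time_gt:
  assumes "x0 + real n < x" "x \<le> x0 + real n + 1"
  shows "prob {\<omega>\<in>space M. enat m < hitting_time \<eta> x0 x \<omega>}
    = (\<Sum>l\<le>n. if l \<le> m then visit_prob l * avoid_prob (m - l) else 0)"
proof -
  have "{\<omega>\<in>space M. enat m < hitting_time \<eta> x0 x \<omega>}
      = space M - {\<omega>\<in>space M. \<exists>l\<in>{Suc n..m}. visit 0 l \<omega>}"
    unfolding hitting_time_gt_iff_no_visit[OF assms] by auto
  moreover have "{\<omega>\<in>space M. \<exists>l\<in>{Suc n..m}. visit 0 l \<omega>} \<in> events" by measurable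
  ultimately have "prob {\<omega>\<in>space M. enat m < hitting_time \<eta> x0 x \<omega>}
      = 1 - prob {\<omega>\<in>space M. \<exists>l\<in>{Suc n..m}. visit 0 l \<omega>}"
    by (simp add: prob_compl)
  also have "prob {\<omega>\<in>space M. \<exists>l\<in>{Suc n..m}. visit 0 l \<omega>}
      = (\<Sum>l\<in>{Suc n..m}. visit_prob l * avoid_prob (m - l))"
  proof -
    have "prob {\<omega>\<in>space M. avoid l m \<omega>} = avoid_prob (m - l)" if "l \<in> {Suc n..m}" for l
      using prob_avoid[of l "m - l"] that by simp
    then show ?thesis using prob_some_visit[of 0 "Suc n" m] by simp
  qed
  also have "1 = (\<Sum>l\<le>m. visit_prob l * avoid_prob (m - l))"
    by (simp add: visit_avoid_convolution)
  also have "\<dots> = (\<Sum>l\<in>{l\<in>{..n}. l \<le> m} \<union> {Suc n..m}. visit_prob l * avoid_prob (m - l))"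
    by (intro sum.cong) auto
  also have "\<dots> = (\<Sum>l\<in>{l\<in>{..n}. l \<le> m}. visit_prob l * avoid_prob (m - l))
      + (\<Sum>l\<in>{Suc n..m}. visit_prob l * avoid_prob (m - l))"
    by (rule sum.union_disjoint) auto
  also have "(\<Sum>l\<in>{l\<in>{..n}. l \<le> m}. visit_prob l * avoid_prob (m - l))
     = (\<Sum>l\<le>n. if l \<le> m then visit_prob l * avoid_prob (m - l) else 0)"
    by (rule sum.inter_filter) simp
  finally show ?thesis by simp
qed

lemma expected_hitting_time_eq:
  assumes "x0 + real n < x" "x \<le> x0 + real n + 1"
  shows "expected_hitting_time M \<eta> x0 x
    = (\<Sum>m. ennreal (prob {\<omega>\<in>space M. enat m < hitting_time \<eta> x0 x \<omega>}))"
proof -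
  note gt [measurable] = hitting_time_gt_event[OF assms]
  have gt': "Measurable.pred M (\<lambda>\<omega>. enat m < hitting_time \<eta> x0 x \<omega>)" for m
    using gt[of m] by (simp add: pred_def)
  have "hitting_time \<eta> x0 x \<in> measurable M (count_space UNIV)"
    unfolding measurable_count_space_eq2_countable
  proof (intro conjI ballI)
    fix a :: enat
    have "{\<omega>\<in>space M. hitting_time \<eta> x0 x \<omega> = a} \<in> events"
    proof (cases a)
      case infinity
      have "hitting_time \<eta> x0 x \<omega> = a \<longleftrightarrow> (\<forall>m. enat m < hitting_time \<eta> x0 x \<omega>)" for \<omega>
        unfolding infinity by (cases "hitting_time \<eta> x0 x \<omega>") auto
      then show ?thesis using gt' by simp
    next
      case (enat k)
      have "hitting_time \<eta> x0 x \<omega> = a \<longleftrightarrow>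
          (\<forall>m\<in>{..<k}. enat m < hitting_time \<eta> x0 x \<omega>) \<and> \<not> enat k < hitting_time \<eta> x0 x \<omega>" for \<omega>
        unfolding enat by (cases "hitting_time \<eta> x0 x \<omega>") (auto intro: le_antisym leI)
      then show ?thesis using gt' by simp
    qed
    then show "hitting_time \<eta> x0 x -` {a} \<inter> space M \<in> events"
      by (simp add: vimage_def Int_def conj_commute)
  qed simp
  then show ?thesis
    unfolding expected_hitting_time_def
    by (simp add: nn_integral_enat_function emeasure_eq_measure)
qed

end

section \<open>Mean and tail of the hitting time\<close>

locale max_chain_S_star = max_chain_model +
  assumes S_star: "(\<lambda>y. prob {\<omega>\<in>space M. \<eta> 1 \<omega> \<le> y}) \<in> S_star"
    and level_pos: "0 < prob {\<omega>\<in>space M. \<eta> 1 \<omega> \<le> x0}"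
begin

definition tail :: "real \<Rightarrow> real" where
  "tail y = prob {\<omega>\<in>space M. y < \<eta> 1 \<omega>}"

text \<open>By the renewal theorem this is the reciprocal of the mean return time to the half-line below
  \<open>x0\<close>. For the defective renewal equation it is the missing mass of the step
  weights.\<close>

definition visit_prob_limit :: real where
  "visit_prob_limit = (\<Prod>i. level_prob i)"

lemma tail_eq: "tail y = 1 - prob {\<omega>\<in>space M. \<eta> 1 \<omega> \<le> y}"
proof -
  have "{\<omega>\<in>space M. \<eta> 1 \<omega> \<le> y} \<in> events" by (intro borel_measurable_le rv borel_measurable_const) simp
  moreover have "{\<omega>\<in>space M. y < \<eta> 1 \<omega>} = space M - {\<omega>\<in>space M. \<eta> 1 \<omega> \<le> y}" by auto
  ultimately show ?thesis by (simp add: tail_def prob_compl)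
qed

sublocale tail: S_star_tail tail
  using S_star_imp_tail[OF S_star] tail_eq by presburger

lemma level_prob_tail: "level_prob i = 1 - tail (x0 + real i)"
  by (simp add: level_prob_def tail_eq)

lemma level_prob_pos: "0 < level_prob i"
proof -
  have "tail (x0 + real i) \<le> tail x0" by (rule antimonoD[OF tail.antimono]) simp
  then show ?thesis using level_pos unfolding level_prob_tail tail_eq by simp
qed

lemma level_prob_le_1: "level_prob i \<le> 1"
  by (simp add: level_prob_def)

lemma visit_prob_Suc: "visit_prob (Suc i) = visit_prob i * level_prob i"
  by (simp add: visit_prob_def)

lemma visit_prob_nonneg: "0 \<le> visit_prob i"
  unfolding visit_prob_def by (intro prod_nonneg) (auto simp: level_prob_def)

lemma visit_prob_decseq: "decseq visit_prob"
  unfolding decseq_Suc_iff visit_prob_Suc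
  using mult_left_mono[OF level_prob_le_1 visit_prob_nonneg] by simp

lemma visit_prob_tendsto: "visit_prob \<longlonglongrightarrow> visit_prob_limit" and visit_prob_limit_pos: "0 < visit_prob_limit"
proof -
  have "summable (\<lambda>i. norm (level_prob i - 1))"
    using tail.summable_tail_shift[of x0] tail.nonneg by (simp add: level_prob_tail)
  then have conv: "convergent_prod level_prob"
    using abs_convergent_prod_conv_summable abs_convergent_prod_imp_convergent_prod by blast
  have "(\<lambda>n. visit_prob (Suc n)) \<longlonglongrightarrow> visit_prob_limit"
    using convergent_prod_LIMSEQ[OF conv] by (simp add: visit_prob_def visit_prob_limit_def lessThan_Suc_atMost)
  then show lim: "visit_prob \<longlonglongrightarrow> visit_prob_limit" by (rule LIMSEQ_imp_Suc)
  have "0 \<le> visit_prob_limit" by (rule LIMSEQ_le_const[OF lim]) (use visit_prob_nonneg in auto)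
  moreover have "visit_prob_limit \<noteq> 0"
    unfolding visit_prob_limit_def by (rule prodinf_nonzero[OF conv]) (metis level_prob_pos less_irrefl)
  ultimately show "0 < visit_prob_limit" by simp
qed

lemma avoid_prob_nonneg: "0 \<le> avoid_prob s"
  by (simp add: avoid_prob_def)

lemma avoid_prob_sums: "avoid_prob sums (1 / visit_prob_limit)"
  by (rule renewal_sums[OF _ visit_avoid_convolution visit_prob_decseq visit_prob_tendsto
        visit_prob_limit_pos avoid_prob_nonneg]) (simp add: visit_prob_def)

text \<open>The step weights \<open>b i\<close> are the visit probability, which tends to a positive constant, times the
  tail at \<open>x0 + i\<close>, which is equivalent to the tail at \<open>i\<close>. So the discrete renewal asymptotics
  apply, and the constant is \<open>P * (1 / P) / P\<close> with \<open>P\<close> the limit of the visit probabilities.\<close>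

lemma avoid_prob_asymptotics: "(\<lambda>n. avoid_prob n / tail (real n)) \<longlonglongrightarrow> 1 / visit_prob_limit"
proof -
  define b where "b i = visit_prob i - visit_prob (Suc i)" for i
  have b_eq: "b i = visit_prob i * tail (x0 + real i)" for i
    by (simp add: b_def visit_prob_Suc level_prob_tail algebra_simps)
  have v0: "visit_prob 0 = 1" by (simp add: visit_prob_def)
  have b: "b sums (1 - visit_prob_limit)"
    using telescope_sums'[OF visit_prob_tendsto] v0 unfolding b_def by simp
  have "(\<lambda>n. visit_prob n * (tail (x0 + real n) / tail (real n))) \<longlonglongrightarrow> visit_prob_limit * 1"
    by (intro tendsto_mult visit_prob_tendsto tail.tail_shift_tendsto)
  then have limit: "(\<lambda>n. b n / tail (real n)) \<longlonglongrightarrow> visit_prob_limit" by (simp add: b_eq)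
  have "(\<lambda>n. avoid_prob n / tail (real n)) \<longlonglongrightarrow> visit_prob_limit * suminf avoid_prob / (1 - suminf b)"
  proof (rule defective_renewal_asymptotics[OF tail.discrete_subexp_tail _ limit])
    show "0 \<le> b n" for n using visit_prob_nonneg tail.nonneg by (simp add: b_eq)
    show "summable b" "suminf b < 1" using b visit_prob_limit_pos by (auto simp: sums_iff)
    show "summable avoid_prob" using avoid_prob_sums by (simp add: sums_iff)
    show "avoid_prob (Suc n) = (\<Sum>j\<le>n. b j * avoid_prob (n - j))" for n
      unfolding b_def by (rule renewal_recursion[OF v0 visit_avoid_convolution])
  qed (rule avoid_prob_nonneg)
  moreover have "suminf avoid_prob = 1 / visit_prob_limit" "suminf b = 1 - visit_prob_limit"
    using avoid_prob_sums b by (auto simp: sums_iff)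
  ultimately show ?thesis using visit_prob_limit_pos by simp
qed

lemma hitting_time_tail_asymptotics:
  assumes "x0 + real n < x" "x \<le> x0 + real n + 1"
  shows "(\<lambda>m. prob {\<omega>\<in>space M. enat m < hitting_time \<eta> x0 x \<omega>} / tail (real m))
    \<longlonglongrightarrow> (\<Sum>l\<le>n. visit_prob l) / visit_prob_limit"
proof -
  have "(\<lambda>m. \<Sum>l\<le>n. visit_prob l * ((if l \<le> m then avoid_prob (m - l) else 0) / tail (real m)))
      \<longlonglongrightarrow> (\<Sum>l\<le>n. visit_prob l * (1 / visit_prob_limit))"
  proof (intro tendsto_sum tendsto_mult_left)
    fix l
    show "(\<lambda>m. (if l \<le> m then avoid_prob (m - l) else 0) / tail (real m)) \<longlonglongrightarrow> 1 / visit_prob_limit"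
    proof (rule LIMSEQ_offset[where k = l])
      have "(\<lambda>m. tail (real m) / tail (real (m + l))) \<longlonglongrightarrow> 1"
        by (rule ratio_shift_tendsto)
          (use tail.discrete_subexp_tail in \<open>auto simp: discrete_subexp_def\<close>)
      from tendsto_mult[OF avoid_prob_asymptotics this]
      show "(\<lambda>m. (if l \<le> m + l then avoid_prob (m + l - l) else 0) / tail (real (m + l))) \<longlonglongrightarrow> 1 / visit_prob_limit"
        using tail.pos by (simp add: less_imp_neq[THEN not_sym])
    qed
  qed
  moreover have "(\<Sum>l\<le>n. visit_prob l * ((if l \<le> m then avoid_prob (m - l) else 0) / tail (real m)))
     = prob {\<omega>\<in>space M. enat m < hitting_time \<eta> x0 x \<omega>} / tail (real m)" for m
    unfolding prob_hitting_time_gt[OF assms] sum_divide_distrib by (intro sum.cong) auto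
  moreover have "(\<Sum>l\<le>n. visit_prob l * (1 / visit_prob_limit)) = (\<Sum>l\<le>n. visit_prob l) / visit_prob_limit"
    by (simp add: sum_divide_distrib)
  ultimately show ?thesis by simp
qed

lemma expected_hitting_time_value:
  assumes "x0 + real n < x" "x \<le> x0 + real n + 1"
  shows "expected_hitting_time M \<eta> x0 x = ennreal ((\<Sum>l\<le>n. visit_prob l) / visit_prob_limit)"
proof -
  have "(\<lambda>m. \<Sum>l\<le>n. visit_prob l * (if l \<le> m then avoid_prob (m - l) else 0))
      sums (\<Sum>l\<le>n. visit_prob l * (1 / visit_prob_limit))"
  proof (intro sums_sum sums_mult)
    fix l
    have "(\<lambda>m. (if l \<le> m + l then avoid_prob (m + l - l) else 0)) sums (1 / visit_prob_limit)"
      using avoid_prob_sums by simp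
    then show "(\<lambda>m. (if l \<le> m then avoid_prob (m - l) else 0)) sums (1 / visit_prob_limit)"
      by (subst (asm) sums_iff_shift) simp
  qed
  moreover have "(\<Sum>l\<le>n. visit_prob l * (if l \<le> m then avoid_prob (m - l) else 0))
      = prob {\<omega>\<in>space M. enat m < hitting_time \<eta> x0 x \<omega>}" for m
    unfolding prob_hitting_time_gt[OF assms] by (intro sum.cong) auto
  moreover have "(\<Sum>l\<le>n. visit_prob l * (1 / visit_prob_limit)) = (\<Sum>l\<le>n. visit_prob l) / visit_prob_limit"
    by (simp add: sum_divide_distrib)
  ultimately have "(\<lambda>m. prob {\<omega>\<in>space M. enat m < hitting_time \<eta> x0 x \<omega>})
      sums ((\<Sum>l\<le>n. visit_prob l) / visit_prob_limit)" by simp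
  then show ?thesis
    unfolding expected_hitting_time_eq[OF assms] by (intro suminf_ennreal_eq) auto
qed

lemma hitting_time_tail_equivalent:
  assumes "x0 < x"
  shows "(\<lambda>m. prob {\<omega>\<in>space M. enat m < hitting_time \<eta> x0 x \<omega>}) \<sim>[sequentially]
    (\<lambda>m. enn2real (expected_hitting_time M \<eta> x0 x) * tail (real m))"
proof -
  \<comment> \<open>The starting points are split into the intervals \<open>(x0 + n, x0 + n + 1]\<close>, closed on the right; hence the ceiling.\<close>
  define n where "n = nat (\<lceil>x - x0\<rceil> - 1)"
  have n: "x0 + real n < x" "x \<le> x0 + real n + 1"
    using assms unfolding n_def by linarith+
  define E where "E = (\<Sum>l\<le>n. visit_prob l) / visit_prob_limit"
  have "visit_prob 0 \<le> (\<Sum>l\<le>n. visit_prob l)"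
    by (rule member_le_sum) (auto simp: visit_prob_nonneg)
  then have E: "0 < E" using visit_prob_limit_pos by (simp add: E_def visit_prob_def)
  have "(\<lambda>m. prob {\<omega>\<in>space M. enat m < hitting_time \<eta> x0 x \<omega>} / tail (real m) / E) \<longlonglongrightarrow> E / E"
    using hitting_time_tail_asymptotics[OF n] E unfolding E_def[symmetric]
    by (intro tendsto_divide tendsto_const) auto
  then show ?thesis
    unfolding expected_hitting_time_value[OF n] E_def[symmetric] using E
    by (intro asymp_equivI') (simp add: mult.commute)
qed

lemma expected_hitting_time_product_formula:
  assumes "x \<in> {x0 + real n<..x0 + real n + 1}"
  shows "expected_hitting_time M \<eta> x0 x
    = ennreal (1 / (\<Prod>k. level_prob k) * (1 + (\<Sum>j=1..n. \<Prod>k=0..j-1. level_prob k)))"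
proof -
  have "{..n} = insert 0 {1..n}" by auto
  moreover have "visit_prob j = (\<Prod>k=0..j-1. level_prob k)" if "j \<in> {1..n}" for j
    using that unfolding visit_prob_def by (intro prod.cong) auto
  ultimately have "(\<Sum>l\<le>n. visit_prob l) = 1 + (\<Sum>j=1..n. \<Prod>k=0..j-1. level_prob k)"
    by (simp add: visit_prob_def)
  then show ?thesis
    using expected_hitting_time_value[of n x] assms by (simp add: visit_prob_limit_def)
qed

end

theorem theorem5:
  fixes M :: "'a measure" and \<eta> :: "nat \<Rightarrow> 'a \<Rightarrow> real"
    and F :: "real \<Rightarrow> real" and x0 :: real
  assumes "prob_space M"
    and indep: "prob_space.indep_vars M (\<lambda>_. borel) \<eta> {1..}"
    and ident: "\<And>n. n \<ge> 1 \<Longrightarrow> distr M borel (\<eta> n) = distr M borel (\<eta> 1)"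
    and F: "\<And>x. F x = \<P>(\<omega> in M. \<eta> 1 \<omega> \<le> x)"
    and x0: "\<P>(\<omega> in M. \<eta> 1 \<omega> \<le> x0) * \<P>(\<omega> in M. \<eta> 1 \<omega> > x0) > 0"
    and mean: "(\<integral>\<^sup>+ \<omega>. ennreal (max 0 (\<eta> 1 \<omega>)) \<partial>M) < \<infinity>"
    and S_star: "F \<in> S_star"
  shows "(\<forall>x>x0. (\<lambda>n::nat. \<P>(\<omega> in M. hitting_time \<eta> x0 x \<omega> > enat n))
             \<sim>[sequentially]
             (\<lambda>n. enn2real (expected_hitting_time M \<eta> x0 x) * \<P>(\<omega> in M. \<eta> 1 \<omega> > real n)))
       \<and> (\<forall>n::nat. \<forall>x\<in>{x0 + real n<..x0 + real n + 1}.
            expected_hitting_time M \<eta> x0 x =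
              ennreal (1 / (\<Prod>k. \<P>(\<omega> in M. \<eta> 1 \<omega> \<le> x0 + real k)) *
                (1 + (\<Sum>j=1..n. \<Prod>k=0..j-1. \<P>(\<omega> in M. \<eta> 1 \<omega> \<le> x0 + real k)))))"
proof -
  interpret prob_space M by fact
  interpret max_chain_S_star M \<eta> x0
  proof
    show "indep_vars (\<lambda>_. borel) \<eta> {1..}" by (rule indep)
    show "distr M borel (\<eta> n) = distr M borel (\<eta> 1)" if "1 \<le> n" for n using that by (rule ident)
    have "(\<lambda>y. prob {\<omega>\<in>space M. \<eta> 1 \<omega> \<le> y}) = F" using F by (intro ext) simp
    then show "(\<lambda>y. prob {\<omega>\<in>space M. \<eta> 1 \<omega> \<le> y}) \<in> S_star" using S_star by simp
    show "0 < prob {\<omega>\<in>space M. \<eta> 1 \<omega> \<le> x0}"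
      using x0 by (simp add: zero_less_mult_iff not_less measure_nonneg less_le)
  qed
  show ?thesis
    using hitting_time_tail_equivalent expected_hitting_time_product_formula
    unfolding tail_def level_prob_def by blast
qed

end
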